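(* For every $n$, there is a clique filtration over $n$ vertices for which the left-to-right matrix reduction of the $1$-dimensional boundary matrix $D$, with reduced matrix $D'$, has fill-in $\#D'=\Theta(n^4)$ and cost $\mathrm{cost}(D)=\Theta(n^7)$ (asymptotics as $n\to\infty$ along this family of filtrations).
   Context: **Matrix reduction.** Matrices have entries in $\mathbb Z_2$. For a non-zero column $M_i$, its pivot $low(M_i)$ is the index of the lowest row (i.e. the largest row index) with a non-zero entry. $\#M_i$ is the number of non-zero entries of column $M_i$, and $\#M=\sum_i\#M_i$. Matrix reduction of $M=(M_1,\dots,M_c)$ is the following algorithm: for $i=1,\dots,c$ in order, set $M'_i:=M_i$; while $M'_i\ne 0$ and there is $j<i$ with $low(M'_j)=low(M'_i)$, replace $M'_i$ by $M'_i+M'_j$. The output $M'=(M'_1,\dots,M'_c)$ is the reduced matrix and $\#M'$ is called the fill-in. The cost of one addition $M'_i\leftarrow M'_i+M'_j$ is $\#M'_j$, and $\mathrm{cost}(M)$ is the sum of the costs of all column additions performed. **Clique filtration.** Consider the full simplex on $n$ vertices with a total order $\sigma_1,\dots,\sigma_r$ on its $r=\binom n2$ edges. For $0\le i\le r$ let $K_i$ be the largest subcomplex containing exactly the edges $\sigma_1,\dots,\sigma_i$ (the clique complex of the graph with these edges); $K_0\subseteq K_1\subseteq\dots\subseteq K_r$ is the clique filtration. A clique filtration also comes with a total order on the triangles compatible with the filtration: triangles are ordered by the index of their last edge in the edge order, and the order among triangles having the same last edge may be chosen freely (it is part of the data). The $1$-dimensional boundary matrix has rows indexed by the edges and columns indexed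 by the triangles, in these orders, with entry $1$ if the edge is contained in the triangle and $0$ otherwise. *)

theory Defs
  imports
    "HOL-Library.Z2"
    "HOL-Library.While_Combinator"
    "HOL-Library.Landau_Symbols"
    "Jordan_Normal_Form.Matrix"
begin

section \<open>Matrix reduction over the two-element field\<close>

definition support :: "bit vec \<Rightarrow> nat set" where
  "support v = {i. i < dim_vec v \<and> v $ i \<noteq> 0}"

definition nnz :: "bit vec \<Rightarrow> nat" where
  "nnz v = card (support v)"

definition nnz_mat :: "bit mat \<Rightarrow> nat" where
  "nnz_mat M = (\<Sum>j<dim_col M. nnz (col M j))"

text \<open>Meaningful only for non-zero vectors.\<close>

definition low :: "bit vec \<Rightarrow> nat" where
  "low v = Max (support v)"

definition reducible_by :: "bit vec \<Rightarrow> bit vec \<Rightarrow> bool" where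
  "reducible_by v u \<longleftrightarrow> support v \<noteq> {} \<and> support u \<noteq> {} \<and> low u = low v"

text \<open>
  The list \<open>R\<close> holds the columns reduced so far. In a run of the algorithm the non-zero
  columns in \<open>R\<close> have pairwise distinct pivots, so the index \<open>j\<close> chosen by \<open>LEAST\<close> is the only
  possible one; and each addition removes the pivot of \<open>v\<close> without affecting lower rows,
  so the loop terminates. The second component accumulates the cost.
\<close>

definition reduce_column :: "bit vec list \<Rightarrow> bit vec \<Rightarrow> bit vec \<times> nat" where
  "reduce_column R v =
     while (\<lambda>(v, c). \<exists>j<length R. reducible_by v (R ! j))
       (\<lambda>(v, c). let u = R ! (LEAST j. j < length R \<and> reducible_by v (R ! j))
                 in (v + u, c + nnz u))
       (v, 0)"

definition reduce_columns :: "bit vec list \<Rightarrow> bit vec list \<times> nat" where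
  "reduce_columns cs =
     fold (\<lambda>v (R, c). let (v', c') = reduce_column R v in (R @ [v'], c + c')) cs ([], 0)"

definition reduced_matrix :: "bit mat \<Rightarrow> bit mat" where
  "reduced_matrix M = mat_of_cols (dim_row M) (fst (reduce_columns (cols M)))"

definition fill_in :: "bit mat \<Rightarrow> nat" where
  "fill_in M = nnz_mat (reduced_matrix M)"

definition reduction_cost :: "bit mat \<Rightarrow> nat" where
  "reduction_cost M = snd (reduce_columns (cols M))"


section \<open>Clique filtrations\<close>

text \<open>Simplices are the non-empty subsets of the vertex set \<open>{..<n}\<close>.\<close>

definition full_simplex :: "nat \<Rightarrow> nat set set" where
  "full_simplex n = {s. s \<noteq> {} \<and> s \<subseteq> {..<n}}"

definition subcomplex :: "nat set set \<Rightarrow> nat set set \<Rightarrow> bool" where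
  "subcomplex K L \<longleftrightarrow> K \<subseteq> L \<and> (\<forall>s\<in>K. \<forall>t. t \<noteq> {} \<and> t \<subseteq> s \<longrightarrow> t \<in> K)"

definition edges_of :: "nat set set \<Rightarrow> nat set set" where
  "edges_of K = {s \<in> K. card s = 2}"

definition triangles_of :: "nat set set \<Rightarrow> nat set set" where
  "triangles_of K = {s \<in> K. card s = 3}"

text \<open>The largest subcomplex whose set of edges is exactly \<open>E\<close>; see \<open>clique_complex_greatest\<close>.\<close>

definition clique_complex :: "nat \<Rightarrow> nat set set \<Rightarrow> nat set set" where
  "clique_complex n E = \<Union>{K. subcomplex K (full_simplex n) \<and> edges_of K = E}"

lemma clique_complex_greatest:
  assumes "E \<subseteq> edges_of (full_simplex n)"
  shows "subcomplex (clique_complex n E) (full_simplex n)"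
    and "edges_of (clique_complex n E) = E"
    and "\<And>K. subcomplex K (full_simplex n) \<Longrightarrow> edges_of K = E \<Longrightarrow> K \<subseteq> clique_complex n E"
proof -
  show "subcomplex (clique_complex n E) (full_simplex n)"
    unfolding subcomplex_def
  proof (intro conjI subsetI ballI allI impI)
    fix s assume "s \<in> clique_complex n E"
    then obtain K where K: "subcomplex K (full_simplex n)" "edges_of K = E" "s \<in> K"
      unfolding clique_complex_def by blast
    then show "s \<in> full_simplex n"
      unfolding subcomplex_def by (elim conjE) (rule subsetD)
    fix t assume "t \<noteq> {} \<and> t \<subseteq> s"
    then have "t \<in> K"
      using K(1,3) by (simp add: subcomplex_def)
    then show "t \<in> clique_complex n E"
      using K(1,2) unfolding clique_complex_def by (intro UnionI CollectI conjI)
  qed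
  show greatest: "K \<subseteq> clique_complex n E"
    if "subcomplex K (full_simplex n)" "edges_of K = E" for K
    unfolding clique_complex_def using that by (intro Union_upper CollectI conjI)
  define K where "K = E \<union> {s \<in> full_simplex n. card s = 1}"
  have E: "s \<in> full_simplex n" "card s = 2" if "s \<in> E" for s
    using that assms unfolding edges_of_def by blast+
  have K: "s \<in> full_simplex n" "card s = 2 \<or> card s = 1" if "s \<in> K" for s
    using that E unfolding K_def by blast+
  have "t \<in> K" if s: "s \<in> K" and t: "t \<noteq> {}" "t \<subseteq> s" for s t
  proof (cases "t = s")
    case False
    have sub: "s \<subseteq> {..<n}"
      using K(1)[OF s] by (simp add: full_simplex_def)
    then have fin: "finite s"
      by (rule finite_subset) simp
    have "card t < card s"
      using t(2) False fin by (simp add: psubset_card_mono psubsetI)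
    moreover have "card t \<noteq> 0"
      using t fin finite_subset[OF t(2) fin] by simp
    ultimately have "card t = 1"
      using K(2)[OF s] by linarith
    moreover have "t \<in> full_simplex n"
      using t sub by (simp add: full_simplex_def subset_trans[OF t(2) sub])
    ultimately show ?thesis
      by (simp add: K_def)
  qed (use s in simp)
  then have "subcomplex K (full_simplex n)"
    unfolding subcomplex_def by (intro conjI subsetI ballI allI impI) (simp_all add: K(1))
  moreover have K_edges: "edges_of K = E"
  proof (rule Set.set_eqI)
    fix s
    show "s \<in> edges_of K \<longleftrightarrow> s \<in> E"
      using E(2)[of s] by (auto simp: edges_of_def K_def)
  qed
  ultimately have sub: "K \<subseteq> clique_complex n E"
    by (rule greatest)
  show "edges_of (clique_complex n E) = E"
  proof (rule Set.set_eqI, rule iffI)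
    fix s assume "s \<in> edges_of (clique_complex n E)"
    then obtain L where "edges_of L = E" "s \<in> L" "card s = 2"
      unfolding clique_complex_def edges_of_def by blast
    then show "s \<in> E"
      unfolding edges_of_def by blast
  next
    fix s assume "s \<in> E"
    then have "s \<in> edges_of K"
      using K_edges by simp
    then show "s \<in> edges_of (clique_complex n E)"
      using sub unfolding edges_of_def by blast
  qed
qed

text \<open>
  An edge order is a duplicate-free list \<open>es\<close> of all edges. Indices are 0-based, so \<open>es ! i\<close> is
  the edge that is added in the step from \<open>filtration_step n es i\<close> to
  \<open>filtration_step n es (Suc i)\<close>.
\<close>

definition filtration_step :: "nat \<Rightarrow> nat set list \<Rightarrow> nat \<Rightarrow> nat set set" where
  "filtration_step n es i = clique_complex n (set (take i es))"

definition last_edge :: "nat set list \<Rightarrow> nat set \<Rightarrow> nat" where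
  "last_edge es t = Max {i. i < length es \<and> es ! i \<subseteq> t}"

text \<open>
  The edge order determines the complexes of the filtration; the order \<open>ts\<close> of the triangles is
  part of the data, and free among triangles with the same last edge.
\<close>

locale clique_filtration =
  fixes n :: nat and es :: "nat set list" and ts :: "nat set list"
  assumes distinct_edges: "distinct es"
    and set_edges: "set es = edges_of (full_simplex n)"
    and distinct_triangles: "distinct ts"
    and set_triangles: "set ts = triangles_of (filtration_step n es (length es))"
    and triangles_sorted: "sorted_wrt (\<lambda>s t. last_edge es s \<le> last_edge es t) ts"

lemma (in clique_filtration) filtration_last:
  "filtration_step n es (length es) = full_simplex n"
proof
  have ok: "set es \<subseteq> edges_of (full_simplex n)"
    by (simp add: set_edges)
  show "filtration_step n es (length es) \<subseteq> full_simplex n"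
    using clique_complex_greatest(1)[OF ok]
    by (simp add: filtration_step_def subcomplex_def)
  have "subcomplex (full_simplex n) (full_simplex n)"
    unfolding subcomplex_def full_simplex_def by blast
  then show "full_simplex n \<subseteq> filtration_step n es (length es)"
    unfolding filtration_step_def take_all[OF order_refl]
    by (rule clique_complex_greatest(3)[OF ok]) (simp add: set_edges)
qed

definition boundary_matrix :: "nat set list \<Rightarrow> nat set list \<Rightarrow> bit mat" where
  "boundary_matrix es ts =
     mat (length es) (length ts) (\<lambda>(i, j). if es ! i \<subseteq> ts ! j then 1 else 0)"

end

theory Submission imports Defs begin

text \<open>
  The upper bounds hold for every clique filtration. Reduced columns have distinct pivots,
  so there are at most as many non-zero ones as there are rows, and each has at most that
  many entries; with at most \<open>n ^ 2\<close> edges this bounds the fill-in by \<open>n ^ 4\<close>. While a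
  column is reduced its pivot only moves up, so every other column is added to it at most
  once; hence the cost is at most the number of triangles times the fill-in. The same
  inequality shows that a cost of order \<open>n ^ 7\<close> forces a fill-in of order \<open>n ^ 4\<close>. It
  remains to find a filtration in which cubically many columns each use quadratically many
  reduced columns with quadratically many entries each.

  The gadget for this is a fan. Its rungs are edges \<open>e\<^sub>0, e\<^sub>1, \<dots>\<close>, each
  joining an apex to a vertex on the rim, and two consecutive rungs span a triangle whose
  third edge is called the residue \<open>r\<^sub>k\<close>. The residues are added first and then the
  rungs, from the last one to \<open>e\<^sub>0\<close>. The triangle of \<open>e\<^sub>k\<close> and its successor is
  put first among those with last edge \<open>e\<^sub>k\<close>, so its column is not reduced and has
  pivot \<open>e\<^sub>k\<close> (\<open>opening_column\<close>). Consequently a later column that contains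
  \<open>e\<^sub>0\<close> is reduced by the whole fan, and \<open>e\<^sub>0\<close> is replaced by the last rung plus
  the sum of all residues (\<open>fan_telescope\<close>). A single apex would give only linearly many
  residues. Here the apex changes from time to time while the rim runs through a trail of
  quadratic length in a complete bipartite graph (\<open>residue_inj\<close>), so that quadratically many
  residues remain.

  Two fans are nested. The residues of the first one are among the oldest edges. The edges
  of a second complete bipartite graph, the grid edges, are coned off from one vertex in
  such a way that the boundary of the triangle on a grid edge \<open>p\<close> reduces to \<open>p + e\<^sub>0\<close>
  plus old edges, and then to \<open>p\<close> plus quadratically many old edges: a dense column with
  pivot \<open>p\<close> (\<open>grid_column_added\<close>, \<open>grid_column_weight\<close>). The second fan has grid edges as
  its residues, except where the apex changes, so its first rung is replaced by a sum of
  quadratically many grid edges. Finally, linearly many vertices are joined to the old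
  bipartite graph, which yields cubically many triangles whose boundaries reduce to that
  first rung plus old edges; each of them has to clear all these grid edges and so uses
  quadratically many dense columns (\<open>cone_column_cost\<close>).

  None of this requires following the algorithm step by step. Because pivots are distinct,
  the set of columns that it adds is determined by linear algebra: if a sum of earlier
  columns cancels the entries of a column from some row on, then it contains exactly those
  columns with pivots from that row on that the algorithm adds (\<open>added_iff\<close>), and a
  combination that reaches a pivot not owned by any earlier column is the result
  (\<open>reduced_eq_by_added\<close>).
\<close>

section \<open>Matrix reduction as linear algebra\<close>

text \<open>
  Keeps \<open>+\<close> on bits from being rewritten to exclusive or, so that sums of columns can be
  rearranged as in any commutative group.
\<close>
declare add_bit_eq_xor [simp del] mult_bit_eq_and [simp del]

lemma bit_add_self [simp]: "x + x = (0::bit)"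
  by (cases x) (simp_all flip: mult_2)

lemma bit_add_cancel [simp]: "x + (x + y) = y" for x y :: bit
  by (simp flip: add.assoc)

text \<open>
  In characteristic two the columns that two linear combinations share cancel. This is what
  allows two ways of writing the same vector to be compared by looking at where they differ.
\<close>
lemma sum_bit_sym_diff:
  fixes f :: "'a \<Rightarrow> bit"
  assumes "finite A" "finite B"
  shows "sum f A + sum f B = sum f (sym_diff A B)"
proof -
  have "sum f A = sum f (A - B) + sum f (A \<inter> B)"
    using assms by (metis Diff_Int2 Int_absorb Int_commute add.commute sum.Int_Diff)
  moreover have "sum f B = sum f (B - A) + sum f (A \<inter> B)"
    using assms by (metis Int_commute add.commute sum.Int_Diff)
  ultimately have "sum f A + sum f B = sum f (A - B) + sum f (B - A)"
    by (simp add: ac_simps)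
  also have "\<dots> = sum f (sym_diff A B)"
    using assms by (subst sum.union_disjoint) auto
  finally show ?thesis .
qed

lemma support_finite [simp]: "finite (support v)"
  by (simp add: support_def)

lemma low_in_support: "support v \<noteq> {} \<Longrightarrow> low v \<in> support v"
  by (simp add: low_def)

lemma support_le_low: "i \<in> support v \<Longrightarrow> i \<le> low v"
  by (simp add: low_def)

lemma support_add_reducible:
  assumes "dim_vec v = dim_vec u" "reducible_by v u" "i \<in> support (v + u)"
  shows "i < low v"
proof -
  have low: "low v \<in> support v" "low v \<in> support u"
    using assms(2) low_in_support[of u] low_in_support[of v] by (auto simp: reducible_by_def)
  have "i \<in> support v \<or> i \<in> support u"
    using assms(1,3) by (auto simp: support_def)
  then have "i \<le> low v"
    using assms(2) support_le_low[of i v] support_le_low[of i u] by (auto simp: reducible_by_def)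
  moreover have "i \<noteq> low v"
    using assms(1,3) low by (auto simp: support_def)
  ultimately show ?thesis by simp
qed

text \<open>
  The loop is summarised by linear algebra: the result is the input plus a sum of earlier
  columns, and the pivot of the current vector drops with every addition. Hence a column is
  added at most once (so that \<open>U\<close> can be a set), its pivot lies below everything that is
  left at the end, and the loop stops. The order of the additions carries no further
  information.
\<close>
lemma reduce_column_spec:
  assumes R: "\<forall>u\<in>set R. dim_vec u = d" and v: "dim_vec v = d"
  obtains v' U where "reduce_column R v = (v', \<Sum>j\<in>U. nnz (R ! j))"
    "U \<subseteq> {..<length R}" "dim_vec v' = d"
    "\<And>i. i < d \<Longrightarrow> v' $ i = v $ i + (\<Sum>j\<in>U. R ! j $ i)"
    "\<And>j. j \<in> U \<Longrightarrow> support (R ! j) \<noteq> {}"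
    "\<And>j i. j \<in> U \<Longrightarrow> i \<in> support v' \<Longrightarrow> i < low (R ! j)"
    "\<And>j. j < length R \<Longrightarrow> \<not> reducible_by v' (R ! j)"
proof -
  \<comment> \<open>The loop invariant is the specification without its last clause.\<close>
  define Inv where "Inv = (\<lambda>(w, c). \<exists>U. c = (\<Sum>j\<in>U. nnz (R ! j)) \<and> U \<subseteq> {..<length R} \<and>
    dim_vec w = d \<and> (\<forall>i<d. w $ i = v $ i + (\<Sum>j\<in>U. R ! j $ i)) \<and>
    (\<forall>j\<in>U. support (R ! j) \<noteq> {} \<and> (\<forall>i\<in>support w. i < low (R ! j))))"
  define B where "B = (\<lambda>(w, c::nat). \<exists>j<length R. reducible_by w (R ! j))"
  define step where "step = (\<lambda>(w, c). let u = R ! (LEAST j. j < length R \<and> reducible_by w (R ! j))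
                 in (w + u, c + nnz u))"
  have step: "Inv (step s) \<and> (step s, s) \<in> measure (\<lambda>(w, c). if support w = {} then 0 else Suc (low w))"
    if "Inv s" "B s" for s
  proof -
    obtain w c where s: "s = (w, c)" by (cases s)
    obtain U where U: "c = (\<Sum>j\<in>U. nnz (R ! j))" "U \<subseteq> {..<length R}" "dim_vec w = d"
      "\<forall>i<d. w $ i = v $ i + (\<Sum>j\<in>U. R ! j $ i)"
      "\<forall>j\<in>U. support (R ! j) \<noteq> {} \<and> (\<forall>i\<in>support w. i < low (R ! j))"
      using \<open>Inv s\<close> unfolding s Inv_def by blast
    define j where "j = (LEAST j. j < length R \<and> reducible_by w (R ! j))"
    have j: "j < length R" "reducible_by w (R ! j)"
      using LeastI_ex[of "\<lambda>j. j < length R \<and> reducible_by w (R ! j)"] \<open>B s\<close>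
      unfolding s B_def j_def by blast+
    have s': "step s = (w + R ! j, c + nnz (R ! j))"
      by (simp add: s step_def j_def Let_def)
    have dim: "dim_vec (R ! j) = d" using R j by simp
    have low: "low (R ! j) = low w" "support w \<noteq> {}" "support (R ! j) \<noteq> {}"
      using j(2) by (auto simp: reducible_by_def)
    have "j \<notin> U"
      using U(5) low low_in_support[of w] by fastforce
    have finU: "finite U" using U(2) finite_subset by blast
    have less: "i < low w" if "i \<in> support (w + R ! j)" for i
      using support_add_reducible[OF _ j(2) that] U(3) dim by simp
    have "Inv (step s)"
      unfolding s' Inv_def split
    proof (intro exI[of _ "insert j U"] conjI)
      show "c + nnz (R ! j) = (\<Sum>j\<in>insert j U. nnz (R ! j))"
        using \<open>j \<notin> U\<close> finU by (simp add: U(1))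
      show "insert j U \<subseteq> {..<length R}" using U(2) j by simp
      show "dim_vec (w + R ! j) = d" using dim by simp
      show "\<forall>i<d. (w + R ! j) $ i = v $ i + (\<Sum>j\<in>insert j U. R ! j $ i)"
        using U(4) dim finU \<open>j \<notin> U\<close> by (simp add: ac_simps)
      show "\<forall>k\<in>insert j U. support (R ! k) \<noteq> {} \<and> (\<forall>i\<in>support (w + R ! j). i < low (R ! k))"
      proof
        fix k assume "k \<in> insert j U"
        then show "support (R ! k) \<noteq> {} \<and> (\<forall>i\<in>support (w + R ! j). i < low (R ! k))"
          using less low U(5) low_in_support[OF low(2)] by (metis insertE order.strict_trans)
      qed
    qed
    moreover have "support (w + R ! j) \<noteq> {} \<Longrightarrow> low (w + R ! j) < low w"
      using less low_in_support by blast
    ultimately show ?thesis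
      unfolding s' using low(2) by (auto simp: s)
  qed
  have "Inv (while B step (v, 0)) \<and> \<not> B (while B step (v, 0))"
  proof (rule while_rule2[of Inv])
    show "Inv (v, 0)" unfolding Inv_def split by (rule exI[of _ "{}"]) (simp add: v)
    show "Inv s \<Longrightarrow> B s \<Longrightarrow> Inv (step s) \<and>
      (step s, s) \<in> measure (\<lambda>(w, c). if support w = {} then 0 else Suc (low w))" for s
      by (rule step)
  qed auto
  moreover have "reduce_column R v = while B step (v, 0)"
    by (simp add: reduce_column_def B_def step_def)
  ultimately have "Inv (reduce_column R v)" "\<not> B (reduce_column R v)"
    by simp_all
  then show ?thesis
    using that unfolding Inv_def B_def by (auto simp: split_beta) (metis prod.collapse)
qed

lemma reduce_columns_snoc:
  "reduce_columns (cs @ [v]) =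
     (fst (reduce_columns cs) @ [fst (reduce_column (fst (reduce_columns cs)) v)],
      snd (reduce_columns cs) + snd (reduce_column (fst (reduce_columns cs)) v))"
  by (simp add: reduce_columns_def split_beta)

text \<open>
  \<open>U q\<close> is the set of columns that are added while column \<open>q\<close> is reduced; \<open>R\<close> lists the
  results.
\<close>
definition reduction_trace :: "nat \<Rightarrow> bit vec list \<Rightarrow> bit vec list \<Rightarrow> (nat \<Rightarrow> nat set) \<Rightarrow> bool" where
  "reduction_trace d cs R U \<longleftrightarrow> length R = length cs \<and> (\<forall>q<length cs. dim_vec (R ! q) = d \<and> U q \<subseteq> {..<q} \<and>
     (\<forall>i<d. R ! q $ i = cs ! q $ i + (\<Sum>j\<in>U q. R ! j $ i)) \<and>
     (\<forall>j\<in>U q. support (R ! j) \<noteq> {} \<and> (\<forall>i\<in>support (R ! q). i < low (R ! j))) \<and>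
     (\<forall>j<q. \<not> reducible_by (R ! q) (R ! j)))"

lemma reduce_columns_trace:
  assumes "\<forall>v\<in>set cs. dim_vec v = d"
  shows "\<exists>R U. reduction_trace d cs R U \<and>
    reduce_columns cs = (R, \<Sum>q<length cs. \<Sum>j\<in>U q. nnz (R ! j))"
  using assms
proof (induction cs rule: rev_induct)
  case Nil
  then show ?case
    by (intro exI[of _ "[]"] exI[of _ "\<lambda>_. {}"]) (simp add: reduction_trace_def reduce_columns_def)
next
  case (snoc v cs)
  then obtain R U where RU: "reduction_trace d cs R U"
    "reduce_columns cs = (R, \<Sum>q<length cs. \<Sum>j\<in>U q. nnz (R ! j))" by auto
  have len: "length R = length cs" using RU(1) by (simp add: reduction_trace_def)
  have "\<forall>u\<in>set R. dim_vec u = d"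
    using RU(1) by (auto simp: reduction_trace_def in_set_conv_nth)
  then obtain v' U' where v': "reduce_column R v = (v', \<Sum>j\<in>U'. nnz (R ! j))"
    "U' \<subseteq> {..<length R}" "dim_vec v' = d"
    "\<And>i. i < d \<Longrightarrow> v' $ i = v $ i + (\<Sum>j\<in>U'. R ! j $ i)"
    "\<And>j. j \<in> U' \<Longrightarrow> support (R ! j) \<noteq> {}"
    "\<And>j i. j \<in> U' \<Longrightarrow> i \<in> support v' \<Longrightarrow> i < low (R ! j)"
    "\<And>j. j < length R \<Longrightarrow> \<not> reducible_by v' (R ! j)"
    using reduce_column_spec[of R d v] snoc.prems by auto
  define U2 where "U2 = U(length cs := U')"
  have old: "(R @ [v']) ! j = R ! j" if "j < length cs" for j
    using that len by (simp add: nth_append)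
  have new: "(R @ [v']) ! length cs = v'" using len by (simp add: nth_append)
  have cs: "(cs @ [v]) ! j = cs ! j" if "j < length cs" for j
    using that by (simp add: nth_append)
  have U2: "U2 q \<subseteq> {..<q}" "q < length cs \<Longrightarrow> U2 q = U q" if "q < Suc (length cs)" for q
    using that RU(1) v'(2) len by (auto simp: U2_def reduction_trace_def less_Suc_eq)
  have sumeq: "(\<Sum>j\<in>U2 q. f ((R @ [v']) ! j)) = (\<Sum>j\<in>U2 q. f (R ! j))" if "q < Suc (length cs)"
    for q and f :: "bit vec \<Rightarrow> 'x::comm_monoid_add"
    using U2(1)[OF that] that old by (intro sum.cong) auto
  have "reduction_trace d (cs @ [v]) (R @ [v']) U2"
    unfolding reduction_trace_def
  proof (intro conjI allI impI)
    show "length (R @ [v']) = length (cs @ [v])" using len by simp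
    fix q assume "q < length (cs @ [v])"
    then have q: "q < Suc (length cs)" by simp
    show "U2 q \<subseteq> {..<q}" using U2 q by blast
    have olds: "(R @ [v']) ! j = R ! j" if "j \<in> U2 q" for j
      using that U2(1)[OF q] q old by auto
    have olds': "(R @ [v']) ! j = R ! j" if "j < q" for j
      using that q old by auto
    consider "q < length cs" | "q = length cs" using q by linarith
    then have *: "dim_vec ((R @ [v']) ! q) = d \<and>
      (\<forall>i<d. (R @ [v']) ! q $ i = (cs @ [v]) ! q $ i + (\<Sum>j\<in>U2 q. R ! j $ i)) \<and>
      (\<forall>j\<in>U2 q. support (R ! j) \<noteq> {} \<and> (\<forall>i\<in>support ((R @ [v']) ! q). i < low (R ! j))) \<and>
      (\<forall>j<q. \<not> reducible_by ((R @ [v']) ! q) (R ! j))"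
    proof cases
      case 1
      then show ?thesis
        using RU(1) by (simp add: old cs U2(2)[OF q] reduction_trace_def)
    next
      case 2
      then show ?thesis
        using v' len by (simp add: new U2_def)
    qed
    show "dim_vec ((R @ [v']) ! q) = d" using * by simp
    show "(R @ [v']) ! q $ i = (cs @ [v]) ! q $ i + (\<Sum>j\<in>U2 q. (R @ [v']) ! j $ i)" if "i < d" for i
      using * that sumeq[OF q, of "\<lambda>u. u $ i"] by simp
    show "\<forall>j\<in>U2 q. support ((R @ [v']) ! j) \<noteq> {} \<and> (\<forall>i\<in>support ((R @ [v']) ! q). i < low ((R @ [v']) ! j))"
      using * olds by simp
    show "\<not> reducible_by ((R @ [v']) ! q) ((R @ [v']) ! j)" if "j < q" for j
      using * olds' that by simp
  qed
  moreover have "(\<Sum>q<Suc (length cs). \<Sum>j\<in>U2 q. nnz ((R @ [v']) ! j)) =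
     (\<Sum>q<length cs. \<Sum>j\<in>U q. nnz (R ! j)) + (\<Sum>j\<in>U'. nnz (R ! j))"
  proof -
    have "(\<Sum>q<Suc (length cs). \<Sum>j\<in>U2 q. nnz ((R @ [v']) ! j)) = (\<Sum>q<Suc (length cs). \<Sum>j\<in>U2 q. nnz (R ! j))"
      by (rule sum.cong[OF refl], rule sumeq) simp
    also have "\<dots> = (\<Sum>q<length cs. \<Sum>j\<in>U q. nnz (R ! j)) + (\<Sum>j\<in>U'. nnz (R ! j))"
      by (simp add: U2_def)
    finally show ?thesis .
  qed
  ultimately show ?case
    by (intro exI[of _ "R @ [v']"] exI[of _ U2])
      (simp add: reduce_columns_snoc RU(2) v'(1))
qed

section \<open>Which columns are added\<close>

definition pivot :: "'r set \<Rightarrow> ('r \<Rightarrow> nat) \<Rightarrow> ('r \<Rightarrow> bit) \<Rightarrow> 'r \<Rightarrow> bool" where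
  "pivot E \<rho> v p \<longleftrightarrow> p \<in> E \<and> v p \<noteq> 0 \<and> (\<forall>e\<in>E. v e \<noteq> 0 \<longrightarrow> \<rho> e \<le> \<rho> p)"

text \<open>
  The trace of a matrix reduction, with columns and rows named by arbitrary objects (later:
  triangles and edges) instead of indices. \<open>D\<close> is the input and \<open>R\<close> the output; \<open>\<tau>\<close> and
  \<open>\<rho>\<close> order the columns and rows; \<open>U s\<close> is the set of columns added to \<open>s\<close>.
\<close>
locale column_reduction =
  fixes S :: "'c set" and E :: "'r set" and \<tau> :: "'c \<Rightarrow> nat" and \<rho> :: "'r \<Rightarrow> nat"
    and D R :: "'c \<Rightarrow> 'r \<Rightarrow> bit" and U :: "'c \<Rightarrow> 'c set"
  assumes finite_columns: "finite S" and finite_rows: "finite E"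
    and inj_row_position: "inj_on \<rho> E"
    and added_earlier: "s \<in> S \<Longrightarrow> t \<in> U s \<Longrightarrow> t \<in> S \<and> \<tau> t < \<tau> s"
    and reduced_eq: "s \<in> S \<Longrightarrow> e \<in> E \<Longrightarrow> R s e = D s e + (\<Sum>t\<in>U s. R t e)"
    and added_pivot: "s \<in> S \<Longrightarrow> t \<in> U s \<Longrightarrow> \<exists>p. pivot E \<rho> (R t) p \<and> (\<forall>e\<in>E. R s e \<noteq> 0 \<longrightarrow> \<rho> e < \<rho> p)"
    and pivots_distinct: "s \<in> S \<Longrightarrow> t \<in> S \<Longrightarrow> pivot E \<rho> (R s) p \<Longrightarrow> pivot E \<rho> (R t) p \<Longrightarrow> s = t"
begin

abbreviation piv :: "'c \<Rightarrow> 'r \<Rightarrow> bool" where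
  "piv t \<equiv> pivot E \<rho> (R t)"

definition weight :: "'c \<Rightarrow> nat" where
  "weight s = card {e \<in> E. R s e \<noteq> 0}"

lemma pivotD:
  assumes "pivot E \<rho> v p"
  shows "p \<in> E" "v p \<noteq> 0" "\<And>e. e \<in> E \<Longrightarrow> v e \<noteq> 0 \<Longrightarrow> \<rho> e \<le> \<rho> p"
  using assms by (auto simp: pivot_def)

lemma pivot_exists:
  assumes "e \<in> E" "v e \<noteq> 0"
  obtains p where "pivot E \<rho> v p"
proof -
  let ?X = "{e \<in> E. v e \<noteq> 0}"
  have "finite (\<rho> ` ?X)" "\<rho> ` ?X \<noteq> {}" using finite_rows assms by auto
  then have "Max (\<rho> ` ?X) \<in> \<rho> ` ?X" by (rule Max_in)
  then obtain p where "p \<in> ?X" "\<rho> p = Max (\<rho> ` ?X)" by force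
  then have "pivot E \<rho> v p"
    using \<open>finite (\<rho> ` ?X)\<close> by (auto simp: pivot_def)
  then show ?thesis by (rule that)
qed

lemma pivot_unique: "pivot E \<rho> v p \<Longrightarrow> pivot E \<rho> v q \<Longrightarrow> p = q"
  using inj_onD[OF inj_row_position] pivotD by (metis antisym)

lemma finite_added: "s \<in> S \<Longrightarrow> finite (U s)"
  using added_earlier finite_columns by (meson finite_subset subsetI)

text \<open>
  The main tool. Suppose that some sum over a set \<open>W\<close> of earlier reduced columns cancels all
  entries of column \<open>s\<close> from position \<open>b\<close> on. Then, among the columns with a pivot at \<open>b\<close> or
  later, the algorithm adds exactly those of \<open>W\<close>. Otherwise take the latest pivot \<open>q\<close> of a
  column in which \<open>U s\<close> and \<open>W\<close> differ: the reduced column \<open>s\<close> vanishes after row \<open>q\<close> but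
  not in row \<open>q\<close>, so it shares its pivot with an earlier column, although pivots are
  distinct.
\<close>
lemma added_iff:
  assumes s: "s \<in> S" and W: "\<And>t. t \<in> W \<Longrightarrow> t \<in> S \<and> \<tau> t < \<tau> s"
    and vanish: "\<And>e. e \<in> E \<Longrightarrow> b \<le> \<rho> e \<Longrightarrow> D s e + (\<Sum>t\<in>W. R t e) = 0"
    and t: "piv t p" "b \<le> \<rho> p"
  shows "t \<in> U s \<longleftrightarrow> t \<in> W"
proof (rule ccontr)
  assume neq: "\<not> ?thesis"
  let ?X = "sym_diff (U s) W"
  have fin: "finite (U s)" "finite W"
    using finite_added[OF s] W finite_columns by (auto intro: finite_subset)
  have X: "x \<in> S" "\<tau> x < \<tau> s" if "x \<in> ?X" for x
    using that W added_earlier[OF s] by blast+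
  \<comment> \<open>Two descriptions of the same vector: their difference is a sum over the symmetric difference.\<close>
  have R_s: "R s e = (\<Sum>t\<in>?X. R t e)" if "e \<in> E" "b \<le> \<rho> e" for e
  proof -
    have "R s e = D s e + (\<Sum>t\<in>U s. R t e) + (D s e + (\<Sum>t\<in>W. R t e))"
      using reduced_eq[OF s that(1)] vanish[OF that] by simp
    also have "\<dots> = (\<Sum>t\<in>U s. R t e) + (\<Sum>t\<in>W. R t e)"
      by (simp add: ac_simps)
    finally show ?thesis using sum_bit_sym_diff[OF fin] by simp
  qed
  define Q where "Q = {q. b \<le> \<rho> q \<and> (\<exists>x\<in>?X. piv x q)}"
  have "finite Q" by (rule finite_subset[OF _ finite_rows]) (auto simp: Q_def pivot_def)
  moreover have "p \<in> Q" using neq t by (auto simp: Q_def)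
  ultimately have "Max (\<rho> ` Q) \<in> \<rho> ` Q" by (intro Max_in) auto
  then obtain q where q: "q \<in> Q" "\<rho> q = Max (\<rho> ` Q)" by force
  have q_max: "\<rho> q' \<le> \<rho> q" if "q' \<in> Q" for q'
    using that q(2) \<open>finite Q\<close> by simp
  obtain x where x: "x \<in> ?X" "piv x q" and bq: "b \<le> \<rho> q" using q(1) by (auto simp: Q_def)
  have qE: "q \<in> E" using x(2) by (rule pivotD)
  \<comment> \<open>Only the column with pivot \<open>q\<close> has an entry in row \<open>q\<close> or in a later row.\<close>
  have *: "e = q \<and> y = x" if y: "y \<in> ?X" and e: "e \<in> E" "R y e \<noteq> 0" "\<rho> q \<le> \<rho> e" for y e
  proof -
    obtain q' where q': "piv y q'" using pivot_exists[of e "R y"] e(1,2) by blast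
    have le: "\<rho> e \<le> \<rho> q'" by (rule pivotD(3)[OF q' e(1,2)])
    have "q' \<in> Q" using le e(3) bq y q' by (auto simp: Q_def)
    then have "\<rho> q' \<le> \<rho> q" by (rule q_max)
    then have "\<rho> q' = \<rho> q" "\<rho> e = \<rho> q" using le e(3) by auto
    then have "q' = q" "e = q"
      using inj_onD[OF inj_row_position] qE e(1) pivotD(1)[OF q'] by blast+
    then show ?thesis using pivots_distinct X(1) x y q' by blast
  qed
  have "R s e = 0" if "e \<in> E" "\<rho> q < \<rho> e" for e
  proof -
    have "(\<Sum>t\<in>?X. R t e) = 0"
    proof (rule sum.neutral, rule ballI, rule ccontr)
      fix y assume "y \<in> ?X" "R y e \<noteq> 0"
      then show False using *[of y e] that by simp
    qed
    then show ?thesis using R_s[OF that(1)] bq that(2) by simp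
  qed
  moreover have "R s q \<noteq> 0"
  proof -
    have "(\<Sum>t\<in>?X. R t q) = (\<Sum>t\<in>{x}. R t q)"
      using *[OF _ qE] x(1) fin by (intro sum.mono_neutral_right) auto
    then show ?thesis using R_s[OF qE bq] pivotD(2)[OF x(2)] by simp
  qed
  ultimately have "piv s q"
    using qE by (auto simp: pivot_def) (metis bit.distinct(1) leI)
  then have "x = s" using pivots_distinct X(1) x s by blast
  then show False using X(2)[OF x(1)] by simp
qed

text \<open>
  If a sum of earlier columns brings \<open>s\<close> down to a pivot \<open>p\<close> that nobody owns yet, and only
  columns with later pivots were used, then the algorithm performs the same additions and
  stops at exactly this vector. Knowing the set of additions is essential: the entries
  before the pivot are not reduced any further and depend on it.
\<close>
lemma reduced_eq_by_added:
  assumes s: "s \<in> S" and W: "\<And>t. t \<in> W \<Longrightarrow> t \<in> S \<and> \<tau> t < \<tau> s \<and> (\<exists>q. piv t q \<and> \<rho> p < \<rho> q)"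
    and p: "pivot E \<rho> (\<lambda>e. D s e + (\<Sum>t\<in>W. R t e)) p"
    and free: "\<And>t. t \<in> S \<Longrightarrow> \<tau> t < \<tau> s \<Longrightarrow> \<not> piv t p"
  shows "U s = W"
proof -
  let ?w = "\<lambda>e. D s e + (\<Sum>t\<in>W. R t e)"
  have pE: "p \<in> E" "?w p \<noteq> 0" using p by (auto simp: pivot_def)
  have above: "t \<in> U s \<longleftrightarrow> t \<in> W" if "piv t q" "\<rho> p < \<rho> q" for t q
  proof (rule added_iff[OF s, where b = "Suc (\<rho> p)"])
    show "?w e = 0" if "e \<in> E" "Suc (\<rho> p) \<le> \<rho> e" for e
      using p that by (auto simp: pivot_def dest: bspec[of _ _ e])
  qed (use W that in auto)
  have sub: "W \<subseteq> U s" using W above by blast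
  have "R s p = D s p + (\<Sum>t\<in>U s. R t p)" by (rule reduced_eq[OF s pE(1)])
  also have "(\<Sum>t\<in>U s. R t p) = (\<Sum>t\<in>W. R t p)"
  proof (rule sum.mono_neutral_right[OF finite_added[OF s] sub], rule ballI, rule ccontr)
    fix t assume t: "t \<in> U s - W" "R t p \<noteq> 0"
    obtain q where q: "piv t q" using pivot_exists[of p "R t"] pE(1) t(2) by blast
    have "\<rho> p \<le> \<rho> q" by (rule pivotD(3)[OF q pE(1) t(2)])
    moreover have "\<not> \<rho> p < \<rho> q" using above[OF q] t(1) by blast
    ultimately have "p = q"
      using inj_onD[OF inj_row_position] pE(1) pivotD(1)[OF q] by simp
    then show False using free q added_earlier[OF s] t(1) by blast
  qed
  finally have "R s p \<noteq> 0" using pE(2) by simp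
  then have "U s \<subseteq> W" using added_pivot[OF s] above pE(1) by blast
  with sub show ?thesis by blast
qed

lemma weight_le: "weight s \<le> card E"
  unfolding weight_def using finite_rows by (intro card_mono) auto

lemma card_pivoted_le:
  assumes "A \<subseteq> S" "\<And>t. t \<in> A \<Longrightarrow> \<exists>p. piv t p"
  shows "card A \<le> card E"
proof -
  define f where "f t = (SOME p. piv t p)" for t
  have f: "piv t (f t)" if "t \<in> A" for t
    unfolding f_def using assms(2)[OF that] by (rule someI_ex)
  have "inj_on f A" using f pivots_distinct assms(1) by (metis inj_onI subsetD)
  moreover have "f ` A \<subseteq> E" using f pivotD(1) by blast
  ultimately show ?thesis using finite_rows by (metis card_image card_mono)
qed

text \<open>
  Distinct pivots leave at most one non-zero column per row.
\<close>
lemma total_weight_le: "(\<Sum>s\<in>S. weight s) \<le> card E ^ 2"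
proof -
  let ?A = "{s \<in> S. \<exists>p. piv s p}"
  have A: "card ?A \<le> card E" by (rule card_pivoted_le) auto
  have "weight s = 0" if "s \<in> S - ?A" for s
  proof -
    have "R s e = 0" if "e \<in> E" for e
      using pivot_exists[of e "R s"] that \<open>s \<in> S - ?A\<close> by blast
    then have "{e \<in> E. R s e \<noteq> 0} = {}" by auto
    then show ?thesis by (simp only: weight_def card.empty)
  qed
  then have "(\<Sum>s\<in>S. weight s) = (\<Sum>s\<in>?A. weight s)"
    using finite_columns by (intro sum.mono_neutral_right) auto
  also have "\<dots> \<le> of_nat (card ?A) * card E" by (rule sum_bounded_above) (rule weight_le)
  also have "\<dots> \<le> card E * card E" using A by simp
  finally show ?thesis by (simp add: power2_eq_square)
qed

text \<open>
  Each column is added at most once during the reduction of another one.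
\<close>
lemma total_cost_le: "(\<Sum>s\<in>S. \<Sum>t\<in>U s. weight t) \<le> card S * (\<Sum>s\<in>S. weight s)"
proof -
  have "(\<Sum>s\<in>S. \<Sum>t\<in>U s. weight t) \<le> of_nat (card S) * (\<Sum>s\<in>S. weight s)"
    using added_earlier finite_columns by (intro sum_bounded_above sum_mono2) auto
  then show ?thesis by simp
qed

end

section \<open>Boundary matrices\<close>

definition position :: "'a list \<Rightarrow> 'a \<Rightarrow> nat" where
  "position xs x = (THE i. i < length xs \<and> xs ! i = x)"

lemma position_nth [simp]: "distinct xs \<Longrightarrow> i < length xs \<Longrightarrow> position xs (xs ! i) = i"
  unfolding position_def by (rule the_equality) (auto simp: nth_eq_iff_index_eq)

lemma position_less: "distinct xs \<Longrightarrow> x \<in> set xs \<Longrightarrow> position xs x < length xs"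
  and nth_position: "distinct xs \<Longrightarrow> x \<in> set xs \<Longrightarrow> xs ! position xs x = x"
  by (auto simp: in_set_conv_nth)

lemma inj_on_position: "distinct xs \<Longrightarrow> inj_on (position xs) (set xs)"
  by (rule inj_on_inverseI[where g = "(!) xs"]) (rule nth_position)

lemma sum_set_nth: "distinct xs \<Longrightarrow> (\<Sum>x\<in>set xs. f x) = (\<Sum>i<length xs. f (xs ! i))"
  for f :: "'a \<Rightarrow> nat"
  by (rule sum.reindex_bij_betw[OF bij_betw_nth, symmetric]) auto

text \<open>
  Passage from lists of vectors to triangles and edges: a position in the list of triangles
  names a column, a position in the list of edges names a row.
\<close>
lemma boundary_matrix_reduction:
  assumes es: "distinct es" and ts: "distinct ts"
  obtains R U where
    "column_reduction (set ts) (set es) (position ts) (position es) (\<lambda>t e. of_bool (e \<subseteq> t)) R U"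
    "fill_in (boundary_matrix es ts) = (\<Sum>s\<in>set ts. column_reduction.weight (set es) R s)"
    "reduction_cost (boundary_matrix es ts) =
       (\<Sum>s\<in>set ts. \<Sum>t\<in>U s. column_reduction.weight (set es) R t)"
proof -
  define cs where "cs = cols (boundary_matrix es ts)"
  define d where "d = length es"
  have dim_M: "dim_row (boundary_matrix es ts) = d" by (simp add: boundary_matrix_def d_def)
  have len: "length cs = length ts" by (simp add: cs_def boundary_matrix_def)
  have dims: "\<forall>v\<in>set cs. dim_vec v = d"
    by (auto simp: cs_def cols_def boundary_matrix_def d_def)
  have entry: "cs ! q $ i = of_bool (es ! i \<subseteq> ts ! q)" if "q < length ts" "i < d" for q i
    using that by (simp add: cs_def boundary_matrix_def d_def)
  obtain Rs V where trace: "reduction_trace d cs Rs V"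
    and run: "reduce_columns cs = (Rs, \<Sum>q<length cs. \<Sum>j\<in>V q. nnz (Rs ! j))"
    using reduce_columns_trace[OF dims] by blast
  note tr = trace[unfolded reduction_trace_def len]
  have lenR: "length Rs = length ts" using tr by simp
  have dimR: "dim_vec (Rs ! q) = d" if "q < length ts" for q using tr that by blast
  have V: "V q \<subseteq> {..<q}" if "q < length ts" for q using tr that by simp
  define R where "R t e = Rs ! position ts t $ position es e" for t e
  define U where "U t = (!) ts ` V (position ts t)" for t
  have R_nth: "R (ts ! q) (es ! i) = Rs ! q $ i" if "q < length ts" "i < d" for q i
    using that es ts by (simp add: R_def d_def)
  have supp: "support (Rs ! q) = {i. i < d \<and> R (ts ! q) (es ! i) \<noteq> 0}" if "q < length ts" for q
    using that tr R_nth[OF that] by (auto simp: support_def)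
  have pivot_nth: "pivot (set es) (position es) (R (ts ! q)) p \<longleftrightarrow>
      support (Rs ! q) \<noteq> {} \<and> p = es ! low (Rs ! q)" if q: "q < length ts" for q p
  proof
    assume p: "pivot (set es) (position es) (R (ts ! q)) p"
    then obtain i where i: "i < d" "p = es ! i" by (auto simp: pivot_def in_set_conv_nth d_def)
    then have "i \<in> support (Rs ! q)" using p by (auto simp: supp[OF q] pivot_def)
    moreover have "k \<le> i" if "k \<in> support (Rs ! q)" for k
    proof -
      have k: "k < d" "R (ts ! q) (es ! k) \<noteq> 0" using that by (auto simp: supp[OF q])
      then have "position es (es ! k) \<le> position es (es ! i)"
        using p i unfolding pivot_def d_def by (metis nth_mem)
      then show ?thesis using k(1) i(1) es by (simp add: d_def)
    qed
    ultimately have "low (Rs ! q) = i" unfolding low_def by (intro Max_eqI) auto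
    then show "support (Rs ! q) \<noteq> {} \<and> p = es ! low (Rs ! q)"
      using \<open>i \<in> _\<close> i by auto
  next
    assume a: "support (Rs ! q) \<noteq> {} \<and> p = es ! low (Rs ! q)"
    then have "low (Rs ! q) \<in> support (Rs ! q)" using low_in_support by blast
    then have l: "low (Rs ! q) < d" "R (ts ! q) p \<noteq> 0" using a by (auto simp: supp[OF q])
    show "pivot (set es) (position es) (R (ts ! q)) p"
      unfolding pivot_def
    proof (intro conjI ballI impI)
      show "p \<in> set es" using a l(1) by (simp add: d_def)
      show "R (ts ! q) p \<noteq> 0" by (rule l(2))
      fix e assume e: "e \<in> set es" "R (ts ! q) e \<noteq> 0"
      then obtain k where k: "k < d" "e = es ! k" by (auto simp: in_set_conv_nth d_def)
      then have "k \<in> support (Rs ! q)" using e by (simp add: supp[OF q])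
      then have "k \<le> low (Rs ! q)" by (rule support_le_low)
      then show "position es e \<le> position es p" using k l(1) a es by (simp add: d_def)
    qed
  qed
  have inj_V: "inj_on ((!) ts) (V q)" if "q < length ts" for q
    using V[OF that] that by (intro inj_on_nth[OF ts]) auto
  have red: "column_reduction (set ts) (set es) (position ts) (position es) (\<lambda>t e. of_bool (e \<subseteq> t)) R U"
  proof
    show "finite (set ts)" "finite (set es)" by auto
    show "inj_on (position es) (set es)" by (rule inj_on_position[OF es])
    fix s assume "s \<in> set ts"
    then obtain q where q: "q < length ts" "s = ts ! q" by (auto simp: in_set_conv_nth)
    have Us: "U s = (!) ts ` V q" using q ts by (simp add: U_def)
    show "t \<in> set ts \<and> position ts t < position ts s" if t: "t \<in> U s" for t
    proof -
      obtain j where j: "j \<in> V q" "t = ts ! j" using t unfolding Us by blast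
      then have "j < q" using V[OF q(1)] by auto
      then show ?thesis using j q ts by simp
    qed
    show "R s e = of_bool (e \<subseteq> s) + (\<Sum>t\<in>U s. R t e)" if e: "e \<in> set es" for e
    proof -
      obtain i where i: "i < d" "e = es ! i" using e by (auto simp: in_set_conv_nth d_def)
      have "(\<Sum>t\<in>U s. R t e) = (\<Sum>j\<in>V q. Rs ! j $ i)"
        unfolding Us sum.reindex[OF inj_V[OF q(1)]] o_def
        using V[OF q(1)] q(1) i R_nth by (intro sum.cong) auto
      then show ?thesis using tr q i by (simp add: R_nth entry)
    qed
    show "\<exists>p. pivot (set es) (position es) (R t) p \<and>
        (\<forall>e\<in>set es. R s e \<noteq> 0 \<longrightarrow> position es e < position es p)" if t: "t \<in> U s" for t
    proof -
      obtain j where j: "j \<in> V q" "t = ts ! j" using t by (auto simp: Us)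
      have jl: "j < length ts" using j V[OF q(1)] q(1) by auto
      have ne: "support (Rs ! j) \<noteq> {}" and lt: "\<forall>i\<in>support (Rs ! q). i < low (Rs ! j)"
        using tr q(1) j(1) by blast+
      have ld: "low (Rs ! j) < d" using low_in_support[OF ne] supp[OF jl] by simp
      show ?thesis
      proof (intro exI conjI ballI impI)
        show "pivot (set es) (position es) (R t) (es ! low (Rs ! j))"
          using pivot_nth[OF jl] ne j by simp
        fix e assume e: "e \<in> set es" "R s e \<noteq> 0"
        then obtain i where i: "i < d" "e = es ! i" by (auto simp: in_set_conv_nth d_def)
        then have "i \<in> support (Rs ! q)" using e q by (simp add: supp)
        then show "position es e < position es (es ! low (Rs ! j))"
          using lt i ld es by (simp add: d_def)
      qed
    qed
    fix t p assume "t \<in> set ts" "pivot (set es) (position es) (R s) p"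
      "pivot (set es) (position es) (R t) p"
    moreover from this obtain k where k: "k < length ts" "t = ts ! k"
      by (auto simp: in_set_conv_nth)
    ultimately have *: "support (Rs ! q) \<noteq> {}" "support (Rs ! k) \<noteq> {}"
      "es ! low (Rs ! q) = es ! low (Rs ! k)"
      using pivot_nth q by auto
    have "low (Rs ! q) < d" "low (Rs ! k) < d"
      using low_in_support[OF *(1)] low_in_support[OF *(2)] supp q(1) k(1) by auto
    then have "low (Rs ! q) = low (Rs ! k)"
      using *(3) es by (simp add: d_def nth_eq_iff_index_eq)
    then have "reducible_by (Rs ! q) (Rs ! k)" "reducible_by (Rs ! k) (Rs ! q)"
      using * by (auto simp: reducible_by_def)
    then have "\<not> k < q" "\<not> q < k" using tr q(1) k(1) by blast+
    then have "k = q" by simp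
    then show "s = t" using q k by simp
  qed
  have weight: "column_reduction.weight (set es) R (ts ! q) = nnz (Rs ! q)" if q: "q < length ts" for q
  proof -
    have "{e \<in> set es. R (ts ! q) e \<noteq> 0} = (!) es ` support (Rs ! q)"
      unfolding supp[OF q] by (auto simp: in_set_conv_nth d_def)
    moreover have "inj_on ((!) es) (support (Rs ! q))"
      using supp[OF q] by (intro inj_on_nth[OF es]) (auto simp: d_def)
    ultimately show ?thesis
      unfolding column_reduction.weight_def[OF red] nnz_def by (simp add: card_image)
  qed
  show ?thesis
  proof (rule that[OF red])
    have "fill_in (boundary_matrix es ts) = (\<Sum>q<length ts. nnz (Rs ! q))"
    proof -
      have "reduced_matrix (boundary_matrix es ts) = mat_of_cols d Rs"
        unfolding reduced_matrix_def cs_def[symmetric] run fst_conv dim_M ..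
      moreover have "col (mat_of_cols d Rs) q = Rs ! q" if "q < length ts" for q
        using dimR[OF that] that lenR by (intro col_mat_of_cols carrier_vecI) simp_all
      moreover have "dim_col (mat_of_cols d Rs) = length ts" by (simp add: lenR)
      ultimately show ?thesis unfolding fill_in_def nnz_mat_def by simp
    qed
    also have "\<dots> = (\<Sum>s\<in>set ts. column_reduction.weight (set es) R s)"
      unfolding sum_set_nth[OF ts] using weight by (intro sum.cong) auto
    finally show "fill_in (boundary_matrix es ts) = \<dots>" .
    have "(\<Sum>t\<in>U (ts ! q). column_reduction.weight (set es) R t) = (\<Sum>j\<in>V q. nnz (Rs ! j))"
      if q: "q < length ts" for q
    proof -
      have "U (ts ! q) = (!) ts ` V q" using q ts by (simp add: U_def)
      then show ?thesis
        using V[OF q] q weight by (auto simp: sum.reindex[OF inj_V[OF q]] intro!: sum.cong)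
    qed
    then show "reduction_cost (boundary_matrix es ts) =
        (\<Sum>s\<in>set ts. \<Sum>t\<in>U s. column_reduction.weight (set es) R t)"
      unfolding sum_set_nth[OF ts] reduction_cost_def cs_def[symmetric] run len
      unfolding snd_conv by (intro sum.cong) simp_all
  qed
qed

section \<open>Fans and the order of the edges\<close>

text \<open>
  The vertices come in eight groups; \<open>vx g i\<close> is vertex number \<open>i\<close> of group \<open>g\<close>. Groups 0,
  1, 2 form the first fan (apices, and the two sides of its rim), groups 3, 4, 5 the second
  one. Group 6 holds the apices of the final cones, and \<open>vx 7 0\<close> is the apex of the cone
  between the two fans. Interleaving the groups makes the numbering independent of their
  common size.
\<close>
definition vx :: "nat \<Rightarrow> nat \<Rightarrow> nat" where
  "vx g i = 8 * i + g"

lemma vx_mod [simp]: "g < 8 \<Longrightarrow> vx g i mod 8 = g"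
  by (simp add: vx_def)

lemma vx_div: "g < 8 \<Longrightarrow> vx g i div 8 = i"
  by (simp add: vx_def)

lemma vx_eq_iff [simp]: "g < 8 \<Longrightarrow> g' < 8 \<Longrightarrow> vx g i = vx g' i' \<longleftrightarrow> g = g' \<and> i = i'"
  using vx_mod vx_div by metis

lemma vx_less: "g < 8 \<Longrightarrow> i < 2 * h \<Longrightarrow> 16 * h \<le> n \<Longrightarrow> vx g i < n"
  by (simp add: vx_def)

text \<open>
  The set of groups that a simplex meets, as a bit mask: 3 for groups 0 and 1, 48 for groups
  4 and 5, and so on. Comparing masks separates the families of edges of the construction by
  arithmetic on numerals.
\<close>
definition group_code :: "nat set \<Rightarrow> nat" where
  "group_code e = (\<Sum>g\<in>(\<lambda>v. v mod 8) ` e. 2 ^ g)"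

lemma group_code_pair [simp]:
  "g < 8 \<Longrightarrow> g' < 8 \<Longrightarrow> group_code {vx g i, vx g' i'} = (if g = g' then 2 ^ g else 2 ^ g + 2 ^ g')"
  by (simp add: group_code_def)

text \<open>
  All groups have \<open>2 * h\<close> members. A fan runs through \<open>h\<close> apices; while the apex \<open>vx g j\<close>
  stays fixed, its rim follows a path in the complete bipartite graph on groups \<open>g + 1\<close> and
  \<open>g + 2\<close> that visits all of their \<open>4 * h\<close> vertices but one.
\<close>
locale nested_fans =
  fixes h :: nat
  assumes h: "0 < h"
begin

definition period :: nat where "period = 4 * h - 1"

definition steps :: nat where "steps = h * period - 1"

definition apex :: "nat \<Rightarrow> nat \<Rightarrow> nat" where
  "apex g k = vx g (k div period)"

text \<open>
  For the \<open>j\<close>-th apex the rim alternates between the vertices \<open>i - j\<close> of group \<open>g + 1\<close> and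
  \<open>i + j\<close> of group \<open>g + 2\<close>, all taken modulo \<open>2 * h\<close>. An edge of this path joins vertices
  whose difference is \<open>2 * j\<close> or \<open>2 * j - 1\<close>, so that no edge occurs for two apices; and the
  path for \<open>j\<close> ends at the vertex \<open>- j - 1\<close> of group \<open>g + 1\<close>, where the path for \<open>j + 1\<close>
  begins.
\<close>
definition rim :: "nat \<Rightarrow> nat \<Rightarrow> nat" where
  "rim g k = (let j = k div period; t = k mod period in
     if even t then vx (g + 1) ((t div 2 + (2 * h - j)) mod (2 * h))
     else vx (g + 2) ((t div 2 + j) mod (2 * h)))"

definition rung :: "nat \<Rightarrow> nat \<Rightarrow> nat set" where
  "rung g k = {apex g k, rim g k}"

definition fan :: "nat \<Rightarrow> nat \<Rightarrow> nat set" where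
  "fan g k = rung g k \<union> rung g (Suc k)"

definition fan_steps :: "nat set" where
  "fan_steps = {k. k < steps \<and> Suc (k mod period) < period}"

text \<open>
  Two consecutive rungs share either their apex or their rim vertex; the residue is the
  third edge of the triangle that they span.
\<close>
definition residue :: "nat \<Rightarrow> nat \<Rightarrow> nat set" where
  "residue g k = (if k \<in> fan_steps then {rim g k, rim g (Suc k)} else {apex g k, apex g (Suc k)})"

text \<open>
  The edges that are added first: the residues of the first fan, those of the second fan at
  a change of apex, the last rung of each fan, and edges that the cones use.
\<close>
inductive_set old_edges :: "nat set set" where
  last0: "rung 0 steps \<in> old_edges"
| last3: "rung 3 steps \<in> old_edges"
| path0: "Suc j < h \<Longrightarrow> {vx 0 j, vx 0 (Suc j)} \<in> old_edges"
| path3: "Suc j < h \<Longrightarrow> {vx 3 j, vx 3 (Suc j)} \<in> old_edges"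
| grid12: "i < 2 * h \<Longrightarrow> k < 2 * h \<Longrightarrow> {vx 1 i, vx 2 k} \<in> old_edges"
| star04: "i < 2 * h \<Longrightarrow> {vx 0 0, vx 4 i} \<in> old_edges"
| star15: "i < 2 * h \<Longrightarrow> {vx 1 0, vx 5 i} \<in> old_edges"
| star31: "i < 2 * h \<Longrightarrow> {vx 3 0, vx 1 i} \<in> old_edges"
| star42: "i < 2 * h \<Longrightarrow> {vx 4 0, vx 2 i} \<in> old_edges"
| star46: "i < 2 * h \<Longrightarrow> {vx 6 i, vx 4 0} \<in> old_edges"
| tip: "{vx 7 0, vx 1 0} \<in> old_edges"

definition grid_edges :: "nat set set" where
  "grid_edges = {{vx 4 i, vx 5 k} | i k. i < 2 * h \<and> k < 2 * h}"

text \<open>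
  The order of the edges, up to ties. The rungs of a fan are added from the last to the
  first, which makes each rung the latest edge of the triangle that it spans with its
  successor.
\<close>
inductive stage :: "nat set \<Rightarrow> nat \<Rightarrow> bool" where
  old: "e \<in> old_edges \<Longrightarrow> stage e 0"
| grid: "e \<in> grid_edges \<Longrightarrow> stage e 1"
| rung0: "k < steps \<Longrightarrow> stage (rung 0 k) (2 + (steps - k))"
| cone0: "stage {vx 7 0, vx 0 0} (steps + 3)"
| cone4: "i < 2 * h \<Longrightarrow> stage {vx 7 0, vx 4 i} (steps + 4)"
| cone5: "i < 2 * h \<Longrightarrow> stage {vx 7 0, vx 5 i} (steps + 5)"
| rung3: "k < steps \<Longrightarrow> stage (rung 3 k) (steps + 6 + (steps - k))"
| cones3: "c < 2 * h \<Longrightarrow> stage {vx 6 c, vx 3 0} (2 * steps + 7)"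
| cones1: "c < 2 * h \<Longrightarrow> i < 2 * h \<Longrightarrow> stage {vx 6 c, vx 1 i} (2 * steps + 8)"
| cones2: "c < 2 * h \<Longrightarrow> i < 2 * h \<Longrightarrow> stage {vx 6 c, vx 2 i} (2 * steps + 9)"

text \<open>
  Stages are unique (\<open>stage_functional\<close>), so that \<open>LEAST\<close> merely names the stage; all edges
  outside the construction come last.
\<close>
definition key :: "nat set \<Rightarrow> nat" where
  "key e = (if \<exists>a. stage e a then LEAST a. stage e a else 2 * steps + 10)"

text \<open>
  \<open>opens e t\<close> selects a triangle \<open>t\<close> with last edge \<open>e\<close>. It is put in front of the other
  triangles with the same last edge, so that its column is never reduced and owns the pivot
  \<open>e\<close>.
\<close>
inductive opens :: "nat set \<Rightarrow> nat set \<Rightarrow> bool" where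
  fan0: "k < steps \<Longrightarrow> opens (rung 0 k) (fan 0 k)"
| cone0: "opens {vx 7 0, vx 0 0} {vx 7 0, vx 0 0, vx 1 0}"
| cone4: "i < 2 * h \<Longrightarrow> opens {vx 7 0, vx 4 i} {vx 7 0, vx 4 i, vx 0 0}"
| cone5: "i < 2 * h \<Longrightarrow> opens {vx 7 0, vx 5 i} {vx 7 0, vx 5 i, vx 1 0}"
| fan3: "k < steps \<Longrightarrow> opens (rung 3 k) (fan 3 k)"
| cones3: "c < 2 * h \<Longrightarrow> opens {vx 6 c, vx 3 0} {vx 6 c, vx 3 0, vx 4 0}"
| cones1: "c < 2 * h \<Longrightarrow> i < 2 * h \<Longrightarrow> opens {vx 6 c, vx 1 i} {vx 6 c, vx 1 i, vx 3 0}"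
| cones2: "c < 2 * h \<Longrightarrow> i < 2 * h \<Longrightarrow> opens {vx 6 c, vx 2 i} {vx 6 c, vx 2 i, vx 4 0}"

lemma period: "3 \<le> period" "Suc period = 2 * (2 * h)"
  using h by (auto simp: period_def)

lemma steps_eq: "Suc steps = h * period"
  using h period by (simp add: steps_def)

lemma steps_pos: "0 < steps"
proof -
  have "1 * 3 \<le> h * period" using h period by (intro mult_le_mono) auto
  then show ?thesis using steps_eq by simp
qed

lemma div_period: "k \<le> steps \<Longrightarrow> k div period < h"
  using steps_eq period by (simp add: less_mult_imp_div_less)

lemma apex_in: "k \<le> steps \<Longrightarrow> \<exists>j<h. apex g k = vx g j"
  using div_period by (auto simp: apex_def)

lemma rim_in: "\<exists>i<2 * h. rim g k = vx (g + 1) i \<or> rim g k = vx (g + 2) i"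
proof (cases "even (k mod period)")
  case True
  then show ?thesis using h unfolding rim_def Let_def
    by (intro exI[of _ "(k mod period div 2 + (2 * h - k div period)) mod (2 * h)"]) simp
next
  case False
  then show ?thesis using h unfolding rim_def Let_def
    by (intro exI[of _ "(k mod period div 2 + k div period) mod (2 * h)"]) simp
qed

lemma rung_form:
  assumes "k \<le> steps"
  obtains j i where "j < h" "i < 2 * h" "rung g k = {vx g j, vx (g + 1) i} \<or> rung g k = {vx g j, vx (g + 2) i}"
    "apex g k = vx g j" "rim g k = vx (g + 1) i \<or> rim g k = vx (g + 2) i"
  using apex_in[OF assms, of g] rim_in[of g k] that unfolding rung_def by metis

lemma rim_even: "even (k mod period) \<Longrightarrow>
    rim g k = vx (g + 1) ((k mod period div 2 + (2 * h - k div period)) mod (2 * h))"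
  and rim_odd: "odd (k mod period) \<Longrightarrow>
    rim g k = vx (g + 2) ((k mod period div 2 + k div period) mod (2 * h))"
  by (simp_all add: rim_def)

lemma mod_add_cancel_right:
  "x < m \<Longrightarrow> y < m \<Longrightarrow> (x + c) mod m = (y + c) mod m \<Longrightarrow> x = y" for x y c m :: nat
proof (induction x y rule: linorder_wlog)
  case (le x y)
  then have "m dvd y - x" using mod_eq_dvd_iff_nat[of "x + c" "y + c" m] by simp
  then show ?case using le by (auto dest: dvd_imp_le)
qed simp

lemma rim_mod: "g < 6 \<Longrightarrow> rim g k mod 8 = (if even (k mod period) then g + 1 else g + 2)"
  using vx_mod[of "g + 1"] vx_mod[of "g + 2"] rim_even[of k g] rim_odd[of k g] by simp

lemma parity_half_eq: "even x = even y \<Longrightarrow> x div 2 = y div 2 \<Longrightarrow> x = y" for x y :: nat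
  by (metis even_two_times_div_two odd_two_times_div_two_succ)

lemma div_mod_eq_imp_eq: "x div c = y div c \<Longrightarrow> x mod c = y mod c \<Longrightarrow> x = y" for x y c :: nat
  by (rule trans[OF div_mult_mod_eq[of x c, symmetric] trans[OF _ div_mult_mod_eq[of y c]]]) simp

text \<open>
  The apex determines the lap \<open>k div period\<close>, the group of the rim vertex determines the
  parity of \<open>k mod period\<close>, and within one lap each rim vertex is visited once.
\<close>
lemma rung_inj:
  assumes "k \<le> steps" "k' \<le> steps" "g < 6" "rung g k = rung g k'"
  shows "k = k'"
proof -
  obtain j i where f: "apex g k = vx g j" "rim g k = vx (g + 1) i \<or> rim g k = vx (g + 2) i"
    using rung_form[OF assms(1)] by metis
  obtain j' i' where f': "apex g k' = vx g j'" "rim g k' = vx (g + 1) i' \<or> rim g k' = vx (g + 2) i'"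
    using rung_form[OF assms(2)] by metis
  have eq: "apex g k = apex g k'" "rim g k = rim g k'"
    using assms(3,4) f f' unfolding rung_def by (auto simp: doubleton_eq_iff)
  have div: "k div period = k' div period"
    using eq(1) assms(3) by (simp add: apex_def)
  have lt: "k mod period div 2 < 2 * h" "k' mod period div 2 < 2 * h"
    using period mod_less_divisor[of period k] mod_less_divisor[of period k'] by linarith+
  have par: "even (k mod period) \<longleftrightarrow> even (k' mod period)"
    using eq(2) rim_mod[OF assms(3), of k] rim_mod[OF assms(3), of k'] by (auto split: if_splits)
  have "k mod period div 2 = k' mod period div 2"
  proof (cases "even (k mod period)")
    case True
    then show ?thesis
      using eq(2) assms(3) par div mod_add_cancel_right[OF lt] by (simp add: rim_even)
  next
    case False
    then show ?thesis
      using eq(2) assms(3) par div mod_add_cancel_right[OF lt] by (simp add: rim_odd)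
  qed
  then have "k mod period = k' mod period"
    using par parity_half_eq by blast
  then show ?thesis
    using div div_mod_eq_imp_eq by blast
qed

lemma rung_0: "rung g 0 = {vx g 0, vx (g + 1) 0}"
  by (simp add: rung_def apex_def rim_even)

lemma fan_step:
  assumes "k \<in> fan_steps"
  shows "Suc k div period = k div period" "Suc k mod period = Suc (k mod period)"
    "apex g (Suc k) = apex g k"
proof -
  have *: "Suc (k mod period) < period" using assms by (simp add: fan_steps_def)
  then show m: "Suc k mod period = Suc (k mod period)" unfolding mod_Suc[of k period] by simp
  show "Suc k div period = k div period" unfolding div_Suc m by simp
  then show "apex g (Suc k) = apex g k" by (simp add: apex_def)
qed

text \<open>
  The rim path of one apex ends where that of the next apex begins.
\<close>
lemma switch_step:
  assumes "k < steps" "k \<notin> fan_steps"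
  shows "Suc k div period = Suc (k div period)" "rim g (Suc k) = rim g k"
proof -
  have *: "Suc (k mod period) = period"
  proof -
    have "\<not> Suc (k mod period) < period" using assms by (simp add: fan_steps_def)
    moreover have "k mod period < period" using period by (intro mod_less_divisor) simp
    ultimately show ?thesis by simp
  qed
  then have m0: "Suc k mod period = 0" unfolding mod_Suc[of k period] by simp
  show d: "Suc k div period = Suc (k div period)" unfolding div_Suc m0 by simp
  have t: "k mod period = 2 * (2 * h - 1)" using * period h by simp
  have lt: "Suc (k div period) < h" using div_period[of "Suc k"] assms(1) d by simp
  have "(2 * h - 1 + (2 * h - k div period)) = 2 * h - Suc (k div period) + 2 * h"
    using lt by simp
  then have turn: "(2 * h - 1 + (2 * h - k div period)) mod (2 * h) = (2 * h - Suc (k div period)) mod (2 * h)"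
    by (simp only: mod_add_self2)
  have ev: "even (k mod period)" "k mod period div 2 = 2 * h - 1" unfolding t by simp_all
  have ev': "even (Suc k mod period)" unfolding m0 by simp
  show "rim g (Suc k) = rim g k"
    unfolding rim_even[OF ev(1)] rim_even[OF ev'] ev(2) m0 d turn by simp
qed

section \<open>The rim of a fan is a trail\<close>

text \<open>
  Both parities in one formula: an odd step arrives at the vertex of group \<open>g + 1\<close> that the
  next even step starts from, and \<open>t mod 2\<close> accounts for this shift by one.
\<close>
lemma residue_form:
  assumes "k \<in> fan_steps"
  shows "residue g k =
    {vx (g + 1) ((k mod period div 2 + k mod period mod 2 + (2 * h - k div period)) mod (2 * h)),
     vx (g + 2) ((k mod period div 2 + k div period) mod (2 * h))}"
proof -
  define t j where "t = k mod period" and "j = k div period"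
  note s = fan_step[OF assms, folded t_def j_def]
  have r: "residue g k = {rim g k, rim g (Suc k)}" using assms by (simp add: residue_def)
  show ?thesis
  proof (cases "even t")
    case True
    have a: "rim g k = vx (g + 1) ((t div 2 + (2 * h - j)) mod (2 * h))"
      using rim_even[of k g] True by (simp add: t_def j_def)
    have b: "rim g (Suc k) = vx (g + 2) ((t div 2 + j) mod (2 * h))"
      using rim_odd[of "Suc k" g] True unfolding s by simp
    have "t mod 2 = 0" using True by simp
    then show ?thesis unfolding r a b t_def[symmetric] j_def[symmetric] by simp
  next
    case False
    have a: "rim g k = vx (g + 2) ((t div 2 + j) mod (2 * h))"
      using rim_odd[of k g] False by (simp add: t_def j_def)
    have "Suc t div 2 = Suc (t div 2)" using False by (simp add: odd_Suc_div_two)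
    then have b: "rim g (Suc k) = vx (g + 1) ((Suc (t div 2) + (2 * h - j)) mod (2 * h))"
      using rim_even[of "Suc k" g] False unfolding s by simp
    have "t div 2 + t mod 2 = Suc (t div 2)" using False by (simp add: odd_iff_mod_2_eq_one)
    then show ?thesis unfolding r a b t_def[symmetric] j_def[symmetric] by (simp add: insert_commute)
  qed
qed

text \<open>
  For instantiating statements about groups \<open>g + 1\<close> and \<open>g + 2\<close> so that group numbers remain
  numerals.
\<close>
lemma shifts: "(1::nat) = 0 + 1" "(2::nat) = 0 + 2" "(4::nat) = 3 + 1" "(5::nat) = 3 + 2"
  by simp_all

lemma residue_bounds:
  assumes "k \<in> fan_steps" "a = g + 1" "b = g + 2"
  obtains i i' where "i < 2 * h" "i' < 2 * h" "residue g k = {vx a i, vx b i'}"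
proof (rule that)
  show "residue g k =
    {vx a ((k mod period div 2 + k mod period mod 2 + (2 * h - k div period)) mod (2 * h)),
     vx b ((k mod period div 2 + k div period) mod (2 * h))}"
    unfolding assms(2,3) by (rule residue_form[OF assms(1)])
qed (use h in simp_all)

text \<open>
  With \<open>\<epsilon>\<close> the parity of the step, the difference of the two indices of a rim edge
  is \<open>2 * j - \<epsilon>\<close> modulo \<open>2 * h\<close>. Two such values differ by less than \<open>2 * h\<close> in
  absolute value, so congruence forces equality, and then parity gives \<open>\<epsilon>\<close> and \<open>j\<close>.
\<close>
lemma trail_arith:
  fixes i i' \<epsilon> \<epsilon>' j j' :: nat
  assumes "j < h" "j' < h" "\<epsilon> < 2" "\<epsilon>' < 2" "i < 2 * h" "i' < 2 * h"
    and a: "(i + \<epsilon> + (2 * h - j)) mod (2 * h) = (i' + \<epsilon>' + (2 * h - j')) mod (2 * h)"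
    and b: "(i + j) mod (2 * h) = (i' + j') mod (2 * h)"
  shows "i = i' \<and> \<epsilon> = \<epsilon>' \<and> j = j'"
proof -
  define H where "H = int h"
  have "int (i + \<epsilon> + (2 * h - j)) mod int (2 * h) = int (i' + \<epsilon>' + (2 * h - j')) mod int (2 * h)"
    using arg_cong[OF a, of int] by (simp only: zmod_int)
  then have "int (2 * h) dvd int (i + \<epsilon> + (2 * h - j)) - int (i' + \<epsilon>' + (2 * h - j'))"
    by (simp only: mod_eq_dvd_iff)
  moreover have "int (i + \<epsilon> + (2 * h - j)) = int i + int \<epsilon> + 2 * H - int j"
    "int (i' + \<epsilon>' + (2 * h - j')) = int i' + int \<epsilon>' + 2 * H - int j'"
    using assms(1,2) by (simp_all add: H_def of_nat_diff)
  ultimately have 1: "2 * H dvd (int i + int \<epsilon> + 2 * H - int j) - (int i' + int \<epsilon>' + 2 * H - int j')"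
    by (simp add: H_def)
  have "int (i + j) mod int (2 * h) = int (i' + j') mod int (2 * h)"
    using arg_cong[OF b, of int] by (simp only: zmod_int)
  then have "int (2 * h) dvd int (i + j) - int (i' + j')"
    by (simp only: mod_eq_dvd_iff)
  then have 2: "2 * H dvd (int i + int j) - (int i' + int j')" by (simp add: H_def)
  have D: "2 * H dvd 2 * (int j - int j') - (int \<epsilon> - int \<epsilon>')"
    using dvd_diff[OF 2 1] by (simp add: algebra_simps)
  have bounds: "int j < H" "int j' < H" "int \<epsilon> < 2" "int \<epsilon>' < 2" "0 \<le> H"
    "0 \<le> int j" "0 \<le> int j'" "0 \<le> int \<epsilon>" "0 \<le> int \<epsilon>'"
    using assms(1-4) by (simp_all add: H_def)
  have "2 * (int j - int j') - (int \<epsilon> - int \<epsilon>') = 0"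
  proof (rule ccontr)
    assume "2 * (int j - int j') - (int \<epsilon> - int \<epsilon>') \<noteq> 0"
    then have "2 * H \<le> \<bar>2 * (int j - int j') - (int \<epsilon> - int \<epsilon>')\<bar>"
      using dvd_imp_le_int[OF _ D] bounds(5) by simp
    moreover have "\<bar>2 * (int j - int j') - (int \<epsilon> - int \<epsilon>')\<bar> < 2 * H"
      unfolding abs_less_iff using bounds by auto
    ultimately show False by linarith
  qed
  then have "int (2 * j + \<epsilon>') = int (2 * j' + \<epsilon>)" by simp
  then have eq: "2 * j + \<epsilon>' = 2 * j' + \<epsilon>" by (simp only: of_nat_eq_iff)
  have "\<epsilon>' = (2 * j + \<epsilon>') mod 2" "\<epsilon> = (2 * j' + \<epsilon>) mod 2" using assms(3,4) by simp_all
  then have "j = j' \<and> \<epsilon> = \<epsilon>'" using eq by simp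
  moreover from this have "i = i'" using mod_add_cancel_right[OF assms(5,6)] b by blast
  ultimately show ?thesis by blast
qed

text \<open>
  The rim is a trail: it never uses an edge twice. Therefore the residues do not cancel when
  the triangles of a fan are added up.
\<close>
lemma residue_inj:
  assumes k: "k \<in> fan_steps" "k' \<in> fan_steps" and g: "g < 6" and eq: "residue g k = residue g k'"
  shows "k = k'"
proof -
  have lt: "k mod period div 2 < 2 * h" "k' mod period div 2 < 2 * h"
    using period mod_less_divisor[of period k] mod_less_divisor[of period k'] by linarith+
  have j: "k div period < h" "k' div period < h"
    using k div_period by (simp_all add: fan_steps_def)
  have "k mod period div 2 = k' mod period div 2 \<and> k mod period mod 2 = k' mod period mod 2
      \<and> k div period = k' div period"
    using eq g unfolding residue_form[OF k(1)] residue_form[OF k(2)]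
    by (intro trail_arith j lt) (auto simp: doubleton_eq_iff)
  then show ?thesis using div_mod_eq_imp_eq by metis
qed

lemma residue_0_old:
  assumes "k < steps"
  shows "residue 0 k \<in> old_edges"
proof (cases "k \<in> fan_steps")
  case True
  obtain i i' where "i < 2 * h" "i' < 2 * h" "residue 0 k = {vx 1 i, vx 2 i'}"
    by (rule residue_bounds[OF True shifts(1,2)])
  then show ?thesis by (simp only: old_edges.grid12)
next
  case False
  have "Suc (k div period) < h"
    using div_period[of "Suc k"] assms switch_step(1)[OF assms False] by simp
  then show ?thesis
    using False switch_step(1)[OF assms False] old_edges.path0 by (simp only: residue_def apex_def if_False)
qed

lemma residue_3_grid:
  assumes "k \<in> fan_steps"
  shows "residue 3 k \<in> grid_edges"
proof -
  obtain i i' where "i < 2 * h" "i' < 2 * h" "residue 3 k = {vx 4 i, vx 5 i'}"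
    by (rule residue_bounds[OF assms shifts(3,4)])
  then show ?thesis by (simp only: grid_edges_def) blast
qed

lemma residue_3_old:
  assumes "k < steps" "k \<notin> fan_steps"
  shows "residue 3 k \<in> old_edges"
proof -
  have "Suc (k div period) < h"
    using div_period[of "Suc k"] assms switch_step(1)[OF assms] by simp
  then show ?thesis
    using assms switch_step(1)[OF assms] old_edges.path3 by (simp only: residue_def apex_def if_False)
qed

lemma finite_fan_steps: "finite fan_steps"
  by (simp add: fan_steps_def)

lemma card_fan_steps: "2 * h\<^sup>2 \<le> card fan_steps"
proof -
  let ?f = "\<lambda>(j, t). t + j * period"
  have "inj_on ?f ({..<h} \<times> {..<period - 1})"
  proof (rule inj_on_inverseI)
    fix x assume "x \<in> {..<h} \<times> {..<period - 1}"
    then show "(\<lambda>k. (k div period, k mod period)) (?f x) = x"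
      by (cases x) auto
  qed
  moreover have "?f ` ({..<h} \<times> {..<period - 1}) \<subseteq> fan_steps"
  proof (rule image_subsetI)
    fix x assume "x \<in> {..<h} \<times> {..<period - 1}"
    then obtain j t where x: "x = (j, t)" and *: "j < h" "t < period - 1" by auto
    from *(1) have "Suc j * period \<le> h * period" by (intro mult_le_mono1) simp
    then have "t + j * period < steps" using steps_eq * by simp
    then show "?f x \<in> fan_steps" using * by (simp add: x fan_steps_def)
  qed
  ultimately have "card ({..<h} \<times> {..<period - 1}) \<le> card fan_steps"
    using card_inj_on_le finite_fan_steps by blast
  moreover have "2 * h \<le> period - 1" using h by (simp add: period_def)
  then have "h * (2 * h) \<le> h * (period - 1)" by (rule mult_le_mono2)
  moreover have "card ({..<h} \<times> {..<period - 1}) = h * (period - 1)"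
    unfolding card_cartesian_product card_lessThan ..
  moreover have "h * (2 * h) = 2 * h\<^sup>2" by (simp add: power2_eq_square)
  ultimately show ?thesis by linarith
qed

section \<open>Stages of the edges\<close>

lemma rung_pair:
  assumes "k \<le> steps" "a = g + 1" "b = g + 2"
  obtains j i where "j < h" "i < 2 * h" "rung g k = {vx g j, vx a i}"
  | j i where "j < h" "i < 2 * h" "rung g k = {vx g j, vx b i}"
  using rung_form[OF assms(1), of g] that unfolding assms(2,3) by metis

lemma group_code_rung:
  assumes "k \<le> steps"
  shows group_code_rung_0: "group_code (rung 0 k) = 3 \<or> group_code (rung 0 k) = 5"
    and group_code_rung_3: "group_code (rung 3 k) = 24 \<or> group_code (rung 3 k) = 40"
proof -
  show "group_code (rung 0 k) = 3 \<or> group_code (rung 0 k) = 5"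
  proof (rule rung_pair[OF assms shifts(1,2)])
    fix j i assume e: "rung 0 k = {vx 0 j, vx 1 i}"
    show ?thesis unfolding e by simp
  next
    fix j i assume e: "rung 0 k = {vx 0 j, vx 2 i}"
    show ?thesis unfolding e by simp
  qed
  show "group_code (rung 3 k) = 24 \<or> group_code (rung 3 k) = 40"
  proof (rule rung_pair[OF assms shifts(3,4)])
    fix j i assume e: "rung 3 k = {vx 3 j, vx 4 i}"
    show ?thesis unfolding e by simp
  next
    fix j i assume e: "rung 3 k = {vx 3 j, vx 5 i}"
    show ?thesis unfolding e by simp
  qed
qed

lemma old_edge_codes:
  "e \<in> old_edges \<Longrightarrow> e = rung 0 steps \<or> e = rung 3 steps \<or>
    group_code e \<in> {130, 1, 8, 6, 17, 34, 10, 20, 80}"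
  by (induction rule: old_edges.induct) simp_all

text \<open>
  The mask of an edge determines its stage, except that the rungs of a fan share the masks
  of their two sides; for these the statement keeps the index of the rung.
\<close>
lemma stage_group_code:
  assumes "stage e a"
  shows "(\<exists>k\<le>steps. (group_code e = 3 \<or> group_code e = 5) \<and> e = rung 0 k \<and>
            a = (if k = steps then 0 else 2 + (steps - k)))
    \<or> (\<exists>k\<le>steps. (group_code e = 24 \<or> group_code e = 40) \<and> e = rung 3 k \<and>
            a = (if k = steps then 0 else steps + 6 + (steps - k)))
    \<or> a = 0 \<and> group_code e \<in> {130, 1, 8, 6, 17, 34, 10, 20, 80}
    \<or> a = 1 \<and> group_code e = 48 \<or> a = steps + 3 \<and> group_code e = 129
    \<or> a = steps + 4 \<and> group_code e = 144 \<or> a = steps + 5 \<and> group_code e = 160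
    \<or> a = 2 * steps + 7 \<and> group_code e = 72 \<or> a = 2 * steps + 8 \<and> group_code e = 66
    \<or> a = 2 * steps + 9 \<and> group_code e = 68" (is "?R0 \<or> ?R3 \<or> ?rest")
  using assms
proof (cases rule: stage.cases)
  case old
  from old_edge_codes[OF old(2)] show ?thesis
  proof (elim disjE)
    assume e: "e = rung 0 steps"
    have ?R0 using group_code_rung_0[of steps] unfolding e old(1) by (intro exI[of _ steps]) simp
    then show ?thesis by (rule disjI1)
  next
    assume e: "e = rung 3 steps"
    have ?R3 using group_code_rung_3[of steps] unfolding e old(1) by (intro exI[of _ steps]) simp
    then show ?thesis by (intro disjI1 disjI2)
  next
    assume "group_code e \<in> {130, 1, 8, 6, 17, 34, 10, 20, 80}"
    then show ?thesis using old(1) by (intro disjI2[OF disjI2[OF disjI1[OF conjI]]])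
  qed
next
  case grid
  then obtain i k where "e = {vx 4 i, vx 5 k}" unfolding grid_edges_def by blast
  then have "group_code e = 48" by simp
  then show ?thesis by (simp only: grid(1) simp_thms)
next
  case (rung0 k)
  then have "?R0" using group_code_rung_0[of k] by (intro exI[of _ k]) simp
  then show ?thesis by (rule disjI1)
next
  case (rung3 k)
  then have "?R3" using group_code_rung_3[of k] by (intro exI[of _ k]) simp
  then show ?thesis by (intro disjI1 disjI2)
next
  case cone0
  then have "group_code e = 129" by simp
  then show ?thesis by (simp only: cone0(2) simp_thms)
next
  case (cone4 i)
  then have "group_code e = 144" by simp
  then show ?thesis by (simp only: cone4(2) simp_thms)
next
  case (cone5 i)
  then have "group_code e = 160" by simp
  then show ?thesis by (simp only: cone5(2) simp_thms)
next
  case (cones3 c)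
  then have "group_code e = 72" by simp
  then show ?thesis by (simp only: cones3(2) simp_thms)
next
  case (cones1 c i)
  then have "group_code e = 66" by simp
  then show ?thesis by (simp only: cones1(2) simp_thms)
next
  case (cones2 c i)
  then have "group_code e = 68" by simp
  then show ?thesis by (simp only: cones2(2) simp_thms)
qed

lemma stage_unique:
  assumes "stage e a" "group_code e \<noteq> 3" "group_code e \<noteq> 5" "group_code e \<noteq> 24" "group_code e \<noteq> 40"
  shows "a = (if group_code e = 48 then 1 else if group_code e = 129 then steps + 3
    else if group_code e = 144 then steps + 4 else if group_code e = 160 then steps + 5
    else if group_code e = 72 then 2 * steps + 7 else if group_code e = 66 then 2 * steps + 8
    else if group_code e = 68 then 2 * steps + 9 else 0)"
  using stage_group_code[OF assms(1)] assms(2-)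
  by (elim disjE exE conjE insertE; simp)

lemma stage_rung0:
  assumes "stage e a" "group_code e = 3 \<or> group_code e = 5"
  shows "\<exists>k\<le>steps. e = rung 0 k \<and> a = (if k = steps then 0 else 2 + (steps - k))"
  using stage_group_code[OF assms(1)]
proof (rule disjE)
  assume "\<exists>k\<le>steps. (group_code e = 3 \<or> group_code e = 5) \<and> e = rung 0 k \<and>
            a = (if k = steps then 0 else 2 + (steps - k))"
  then show ?thesis by blast
qed (use assms(2) in \<open>elim disjE exE conjE insertE; simp\<close>)

lemma stage_rung3:
  assumes "stage e a" "group_code e = 24 \<or> group_code e = 40"
  shows "\<exists>k\<le>steps. e = rung 3 k \<and> a = (if k = steps then 0 else steps + 6 + (steps - k))"
  using stage_group_code[OF assms(1)]
proof (elim disjE[of "\<exists>k\<le>steps. P k" for P])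
  assume "\<exists>k\<le>steps. (group_code e = 24 \<or> group_code e = 40) \<and> e = rung 3 k \<and>
            a = (if k = steps then 0 else steps + 6 + (steps - k))"
  then show ?thesis by blast
qed (use assms(2) in \<open>elim disjE exE conjE insertE; simp\<close>)+

lemma stage_functional:
  assumes "stage e a" "stage e b"
  shows "a = b"
proof -
  consider "group_code e = 3 \<or> group_code e = 5" | "group_code e = 24 \<or> group_code e = 40"
    | "group_code e \<noteq> 3" "group_code e \<noteq> 5" "group_code e \<noteq> 24" "group_code e \<noteq> 40" by blast
  then show ?thesis
  proof cases
    case 1
    then obtain k k' where *: "k \<le> steps" "k' \<le> steps" "e = rung 0 k" "e = rung 0 k'"
      "a = (if k = steps then 0 else 2 + (steps - k))" "b = (if k' = steps then 0 else 2 + (steps - k'))"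
      using stage_rung0[OF assms(1)] stage_rung0[OF assms(2)] by blast
    then have "k = k'" by (intro rung_inj[where g = 0]) simp_all
    then show ?thesis unfolding *(5,6) by (rule arg_cong)
  next
    case 2
    then obtain k k' where *: "k \<le> steps" "k' \<le> steps" "e = rung 3 k" "e = rung 3 k'"
      "a = (if k = steps then 0 else steps + 6 + (steps - k))"
      "b = (if k' = steps then 0 else steps + 6 + (steps - k'))"
      using stage_rung3[OF assms(1)] stage_rung3[OF assms(2)] by blast
    then have "k = k'" by (intro rung_inj[where g = 3]) simp_all
    then show ?thesis unfolding *(5,6) by (rule arg_cong)
  next
    case 3
    show ?thesis
      by (rule trans[OF stage_unique[OF assms(1) 3] stage_unique[OF assms(2) 3, symmetric]])
  qed
qed

lemma key_eq: "stage e a \<Longrightarrow> key e = a"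
  unfolding key_def using stage_functional by (metis LeastI)

lemma stage_key: "key e < 2 * steps + 10 \<Longrightarrow> stage e (key e)"
  unfolding key_def by (auto intro: LeastI split: if_splits)

lemmas key_old = key_eq[OF stage.old]
  and key_grid = key_eq[OF stage.grid]
  and key_rung0 = key_eq[OF stage.rung0]
  and key_cone0 = key_eq[OF stage.cone0]
  and key_cone4 = key_eq[OF stage.cone4]
  and key_cone5 = key_eq[OF stage.cone5]
  and key_rung3 = key_eq[OF stage.rung3]
  and key_cones3 = key_eq[OF stage.cones3]
  and key_cones1 = key_eq[OF stage.cones1]
  and key_cones2 = key_eq[OF stage.cones2]

lemma key_0_iff: "key e = 0 \<longleftrightarrow> e \<in> old_edges"
proof
  assume "key e = 0"
  then have "stage e 0" using stage_key[of e] by simp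
  then show "e \<in> old_edges" by (cases rule: stage.cases) auto
qed (rule key_old)

lemma rung_0_0: "rung 0 0 = {vx 0 0, vx 1 0}"
  and rung_3_0: "rung 3 0 = {vx 3 0, vx 4 0}"
  using rung_0[of 0] rung_0[of 3] by simp_all

lemma key_rung_less: "k < steps \<Longrightarrow> key (rung 0 (Suc k)) < key (rung 0 k)"
  "k < steps \<Longrightarrow> key (rung 3 (Suc k)) < key (rung 3 k)"
proof -
  assume k: "k < steps"
  consider "Suc k < steps" | "Suc k = steps" using k by linarith
  then show "key (rung 0 (Suc k)) < key (rung 0 k)"
  proof cases
    case 1
    show ?thesis unfolding key_rung0[OF k] key_rung0[OF 1] using 1 by linarith
  next
    case 2
    show ?thesis unfolding key_rung0[OF k] 2 key_old[OF old_edges.last0] by simp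
  qed
  consider "Suc k < steps" | "Suc k = steps" using k by linarith
  then show "key (rung 3 (Suc k)) < key (rung 3 k)"
  proof cases
    case 1
    show ?thesis unfolding key_rung3[OF k] key_rung3[OF 1] using 1 by linarith
  next
    case 2
    show ?thesis unfolding key_rung3[OF k] 2 key_old[OF old_edges.last3] by simp
  qed
qed

lemma key_residue_less:
  assumes k: "k < steps"
  shows "key (residue 0 k) < key (rung 0 k)" "key (residue 3 k) < key (rung 3 k)"
proof -
  show "key (residue 0 k) < key (rung 0 k)"
    unfolding key_rung0[OF k] key_old[OF residue_0_old[OF k]] by simp
  show "key (residue 3 k) < key (rung 3 k)"
    unfolding key_rung3[OF k]
    using key_old[OF residue_3_old[OF k]] key_grid[OF residue_3_grid[of k]] by (cases "k \<in> fan_steps") simp_all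
qed

lemma apex_rim_neq:
  assumes "g < 6"
  shows "apex g k \<noteq> rim g k'"
proof
  assume "apex g k = rim g k'"
  moreover have "apex g k mod 8 = g" using assms by (simp add: apex_def)
  moreover have "rim g k' mod 8 \<noteq> g" unfolding rim_mod[OF assms] by simp
  ultimately show False by simp
qed

text \<open>
  The two vertices of the current rung, followed by the one vertex that changes in this
  step.
\<close>
lemma fan_shape:
  assumes "k < steps" "g < 6"
  obtains x y z where "fan g k = {x, y, z}" "rung g k = {x, y}" "distinct [x, y, z]"
    "{{x, z}, {y, z}} = {rung g (Suc k), residue g k}"
proof (cases "k \<in> fan_steps")
  case True
  have a: "apex g (Suc k) = apex g k" by (rule fan_step[OF True])
  have "rim g k \<noteq> rim g (Suc k)"
  proof
    assume "rim g k = rim g (Suc k)"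
    then have "rim g k mod 8 = rim g (Suc k) mod 8" by simp
    then show False unfolding rim_mod[OF assms(2)] fan_step(2)[OF True] by (simp split: if_splits)
  qed
  then have d: "distinct [apex g k, rim g k, rim g (Suc k)]"
    using apex_rim_neq[OF assms(2)] by simp
  have f: "fan g k = {apex g k, rim g k, rim g (Suc k)}" unfolding fan_def rung_def a by blast
  have r: "residue g k = {rim g k, rim g (Suc k)}" using True by (simp only: residue_def if_True)
  show ?thesis by (rule that[OF f _ d]) (simp_all only: rung_def a r)
next
  case False
  note s = switch_step[OF assms(1) False]
  have "apex g k \<noteq> apex g (Suc k)" using s(1) assms(2) by (simp add: apex_def)
  then have d: "distinct [rim g k, apex g k, apex g (Suc k)]"
    using apex_rim_neq[OF assms(2)] apex_rim_neq[OF assms(2), symmetric] by simp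
  have f: "fan g k = {rim g k, apex g k, apex g (Suc k)}" unfolding fan_def rung_def s by blast
  have r: "residue g k = {apex g k, apex g (Suc k)}" using False by (simp only: residue_def if_False)
  show ?thesis by (rule that[OF f _ d]) (simp_all only: rung_def s r insert_commute)
qed

lemma fan_vertex: "k < steps \<Longrightarrow> g < 6 \<Longrightarrow> v \<in> fan g k \<Longrightarrow>
    v mod 8 \<in> {g, g + 1, g + 2} \<and> v < 16 * h"
proof -
  assume k: "k < steps" and g: "g < 6" and v: "v \<in> fan g k"
  have r: "v mod 8 \<in> {g, g + 1, g + 2} \<and> v < 16 * h" if le: "l \<le> steps" and v: "v \<in> rung g l" for l
  proof -
    obtain j i where "j < h" "i < 2 * h" "apex g l = vx g j" "rim g l = vx (g + 1) i \<or> rim g l = vx (g + 2) i"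
      by (rule rung_form[OF le, of g])
    then have "v = vx g j \<or> v = vx (g + 1) i \<or> v = vx (g + 2) i" using v by (auto simp: rung_def)
    moreover have "vx g j mod 8 = g" "vx (g + 1) i mod 8 = g + 1" "vx (g + 2) i mod 8 = g + 2"
      using g by (simp_all only: vx_mod)
    moreover have "vx g j < 16 * h" "vx (g + 1) i < 16 * h" "vx (g + 2) i < 16 * h"
      using g \<open>j < h\<close> \<open>i < 2 * h\<close> by (simp_all add: vx_def)
    ultimately show ?thesis by blast
  qed
  show ?thesis using v r[of k] r[of "Suc k"] k by (auto simp: fan_def)
qed

lemma vx_small: "g < 8 \<Longrightarrow> i < 2 * h \<Longrightarrow> vx g i < 16 * h"
  by (simp add: vx_def)

lemma pair_bound:
  fixes f :: "'a \<Rightarrow> nat"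
  assumes "{c, d} = {a, b}" "f c < m" "f d < m"
  shows "f a < m" "f b < m"
  using assms by (metis insertE insertI1 insertI2 singletonD)+

text \<open>
  This is what the stages were chosen for: residues precede the rungs, rungs are added
  backwards, and an apex of a cone is joined to the two hubs of the cone before it is joined
  to the vertices around them.
\<close>
lemma opens_shape:
  assumes "opens e t"
  obtains x y z where "t = {x, y, z}" "e = {x, y}" "distinct [x, y, z]" "{x, y, z} \<subseteq> {..<16 * h}"
    "key {x, z} < key e" "key {y, z} < key e"
  using assms
proof (cases rule: opens.cases)
  case (fan0 k)
  obtain x y z where s: "fan 0 k = {x, y, z}" "rung 0 k = {x, y}" "distinct [x, y, z]"
    "{{x, z}, {y, z}} = {rung 0 (Suc k), residue 0 k}"
    by (rule fan_shape[OF fan0(3), of 0]) simp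
  have less: "key {x, z} < key e" "key {y, z} < key e"
    by (rule pair_bound[OF s(4)[symmetric]]; simp only: fan0(1) key_rung_less(1)[OF fan0(3)] key_residue_less(1)[OF fan0(3)])+
  have small: "{x, y, z} \<subseteq> {..<16 * h}"
    unfolding s(1)[symmetric] using fan_vertex[OF fan0(3), of 0] by (intro subsetI) simp
  show ?thesis
    by (rule that[OF trans[OF fan0(2) s(1)] trans[OF fan0(1) s(2)] s(3) small less])
next
  case (fan3 k)
  obtain x y z where s: "fan 3 k = {x, y, z}" "rung 3 k = {x, y}" "distinct [x, y, z]"
    "{{x, z}, {y, z}} = {rung 3 (Suc k), residue 3 k}"
    by (rule fan_shape[OF fan3(3), of 3]) simp
  have less: "key {x, z} < key e" "key {y, z} < key e"
    by (rule pair_bound[OF s(4)[symmetric]]; simp only: fan3(1) key_rung_less(2)[OF fan3(3)] key_residue_less(2)[OF fan3(3)])+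
  have small: "{x, y, z} \<subseteq> {..<16 * h}"
    unfolding s(1)[symmetric] using fan_vertex[OF fan3(3), of 3] by (intro subsetI) simp
  show ?thesis
    by (rule that[OF trans[OF fan3(2) s(1)] trans[OF fan3(1) s(2)] s(3) small less])
next
  case cone0
  have "key {vx 0 0, vx 1 0} = 2 + steps" using key_rung0[OF steps_pos] rung_0_0 by simp
  moreover have "key {vx 7 0, vx 1 0} = 0" by (rule key_old[OF old_edges.tip])
  ultimately show ?thesis
    using h cone0 key_cone0 by (intro that[of "vx 7 0" "vx 0 0" "vx 1 0"]) (simp_all add: vx_small)
next
  case (cone4 i)
  have "key {vx 4 i, vx 0 0} = 0"
    using key_old[OF old_edges.star04[OF cone4(3)]] by (simp only: insert_commute)
  then show ?thesis
    using h cone4 key_cone4[of i] key_cone0 by (intro that[of "vx 7 0" "vx 4 i" "vx 0 0"]) (simp_all add: vx_small)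
next
  case (cone5 i)
  have "key {vx 5 i, vx 1 0} = 0"
    using key_old[OF old_edges.star15[OF cone5(3)]] by (simp only: insert_commute)
  moreover have "key {vx 7 0, vx 1 0} = 0" by (rule key_old[OF old_edges.tip])
  ultimately show ?thesis
    using h cone5 key_cone5[of i] by (intro that[of "vx 7 0" "vx 5 i" "vx 1 0"]) (simp_all add: vx_small)
next
  case (cones3 c)
  have "key {vx 3 0, vx 4 0} = steps + 6 + steps" using key_rung3[OF steps_pos] rung_3_0 by simp
  moreover have "key {vx 6 c, vx 4 0} = 0" by (rule key_old[OF old_edges.star46[OF cones3(3)]])
  ultimately show ?thesis
    using h cones3 key_cones3[of c] by (intro that[of "vx 6 c" "vx 3 0" "vx 4 0"]) (simp_all add: vx_small)
next
  case (cones1 c i)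
  have "key {vx 1 i, vx 3 0} = 0"
    using key_old[OF old_edges.star31[OF cones1(4)]] by (simp only: insert_commute)
  then show ?thesis
    using h cones1 key_cones1[of c i] key_cones3[of c]
    by (intro that[of "vx 6 c" "vx 1 i" "vx 3 0"]) (simp_all add: vx_small)
next
  case (cones2 c i)
  have "key {vx 2 i, vx 4 0} = 0"
    using key_old[OF old_edges.star42[OF cones2(4)]] by (simp only: insert_commute)
  moreover have "key {vx 6 c, vx 4 0} = 0" by (rule key_old[OF old_edges.star46[OF cones2(3)]])
  ultimately show ?thesis
    using h cones2 key_cones2[of c i]
    by (intro that[of "vx 6 c" "vx 2 i" "vx 4 0"]) (simp_all add: vx_small)
qed

section \<open>Selected triangles and the first cone\<close>

text \<open>
  For comparing two triangles selected at the same edge: the ranges of the keys are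
  disjoint, so that both belong to the same family.
\<close>
lemma opens_by_key:
  assumes "opens e t"
  obtains (fan0) k where "key e \<le> steps + 2" "k < steps" "e = rung 0 k" "t = fan 0 k"
  | (cone0) "key e = steps + 3" "e = {vx 7 0, vx 0 0}" "t = {vx 7 0, vx 0 0, vx 1 0}"
  | (cone4) i where "key e = steps + 4" "e = {vx 7 0, vx 4 i}" "t = {vx 7 0, vx 4 i, vx 0 0}"
  | (cone5) i where "key e = steps + 5" "e = {vx 7 0, vx 5 i}" "t = {vx 7 0, vx 5 i, vx 1 0}"
  | (fan3) k where "steps + 6 \<le> key e" "key e \<le> 2 * steps + 6" "k < steps" "e = rung 3 k" "t = fan 3 k"
  | (cones3) c where "key e = 2 * steps + 7" "e = {vx 6 c, vx 3 0}" "t = {vx 6 c, vx 3 0, vx 4 0}"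
  | (cones1) c i where "key e = 2 * steps + 8" "e = {vx 6 c, vx 1 i}" "t = {vx 6 c, vx 1 i, vx 3 0}"
  | (cones2) c i where "key e = 2 * steps + 9" "e = {vx 6 c, vx 2 i}" "t = {vx 6 c, vx 2 i, vx 4 0}"
  using assms
proof (cases rule: opens.cases)
  case (fan0 k)
  have k0: "key e \<le> steps + 2" unfolding fan0(1) key_rung0[OF fan0(3)] by simp
  show ?thesis by (rule that(1)[OF k0 fan0(3) fan0(1,2)])
next
  case cone0
  have k0: "key e = steps + 3" unfolding cone0(1) key_cone0 by simp
  show ?thesis by (rule that(2)[OF k0 cone0(1,2)])
next
  case (cone4 i)
  have k0: "key e = steps + 4" unfolding cone4(1) key_cone4[OF cone4(3)] by simp
  show ?thesis by (rule that(3)[OF k0 cone4(1,2)])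
next
  case (cone5 i)
  have k0: "key e = steps + 5" unfolding cone5(1) key_cone5[OF cone5(3)] by simp
  show ?thesis by (rule that(4)[OF k0 cone5(1,2)])
next
  case (fan3 k)
  have k0: "steps + 6 \<le> key e" unfolding fan3(1) key_rung3[OF fan3(3)] by simp
  have k1: "key e \<le> 2 * steps + 6" unfolding fan3(1) key_rung3[OF fan3(3)] by simp
  show ?thesis by (rule that(5)[OF k0 k1 fan3(3) fan3(1,2)])
next
  case (cones3 c)
  have k0: "key e = 2 * steps + 7" unfolding cones3(1) key_cones3[OF cones3(3)] by simp
  show ?thesis by (rule that(6)[OF k0 cones3(1,2)])
next
  case (cones1 c i)
  have k0: "key e = 2 * steps + 8" unfolding cones1(1) key_cones1[OF cones1(3,4)] by simp
  show ?thesis by (rule that(7)[OF k0 cones1(1,2)])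
next
  case (cones2 c i)
  have k0: "key e = 2 * steps + 9" unfolding cones2(1) key_cones2[OF cones2(3,4)] by simp
  show ?thesis by (rule that(8)[OF k0 cones2(1,2)])
qed

lemma opens_functional:
  assumes "opens e t" "opens e t'"
  shows "t = t'"
  using assms(1)
proof (cases rule: opens_by_key)
  case (fan0 k)
  note outer = fan0
  from assms(2) show ?thesis
  proof (cases rule: opens_by_key)
    case (fan0 k')
    have "k = k'"
      by (rule rung_inj[where g = 0]) (use outer(2) fan0(2) outer(3) fan0(3) in simp_all)
    then show ?thesis using outer(4) fan0(4) by simp
  qed (use outer(1) in linarith)+
next
  case cone0
  note outer = cone0
  from assms(2) show ?thesis
  proof (cases rule: opens_by_key)
    case cone0
    then show ?thesis using outer(3) by simp
  qed (use outer(1) in linarith)+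
next
  case (cone4 i)
  note outer = cone4
  from assms(2) show ?thesis
  proof (cases rule: opens_by_key)
    case (cone4 i')
    have "{vx 7 0, vx 4 i} = {vx 7 0, vx 4 i'}" using outer(2) cone4(2) by simp
    then have "i = i'" by (simp add: doubleton_eq_iff)
    then show ?thesis using outer(3) cone4(3) by simp
  qed (use outer(1) in linarith)+
next
  case (cone5 i)
  note outer = cone5
  from assms(2) show ?thesis
  proof (cases rule: opens_by_key)
    case (cone5 i')
    have "{vx 7 0, vx 5 i} = {vx 7 0, vx 5 i'}" using outer(2) cone5(2) by simp
    then have "i = i'" by (simp add: doubleton_eq_iff)
    then show ?thesis using outer(3) cone5(3) by simp
  qed (use outer(1) in linarith)+
next
  case (fan3 k)
  note outer = fan3
  from assms(2) show ?thesis
  proof (cases rule: opens_by_key)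
    case (fan3 k')
    have "k = k'"
      by (rule rung_inj[where g = 3]) (use outer(3) fan3(3) outer(4) fan3(4) in simp_all)
    then show ?thesis using outer(5) fan3(5) by simp
  qed (use outer(1,2) in linarith)+
next
  case (cones3 c)
  note outer = cones3
  from assms(2) show ?thesis
  proof (cases rule: opens_by_key)
    case (cones3 c')
    have "{vx 6 c, vx 3 0} = {vx 6 c', vx 3 0}" using outer(2) cones3(2) by simp
    then have "c = c'" by (simp add: doubleton_eq_iff)
    then show ?thesis using outer(3) cones3(3) by simp
  qed (use outer(1) in linarith)+
next
  case (cones1 c i)
  note outer = cones1
  from assms(2) show ?thesis
  proof (cases rule: opens_by_key)
    case (cones1 c' i')
    have "{vx 6 c, vx 1 i} = {vx 6 c', vx 1 i'}" using outer(2) cones1(2) by simp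
    then have "c = c' \<and> i = i'" by (simp add: doubleton_eq_iff)
    then show ?thesis using outer(3) cones1(3) by simp
  qed (use outer(1) in linarith)+
next
  case (cones2 c i)
  note outer = cones2
  from assms(2) show ?thesis
  proof (cases rule: opens_by_key)
    case (cones2 c' i')
    have "{vx 6 c, vx 2 i} = {vx 6 c', vx 2 i'}" using outer(2) cones2(2) by simp
    then have "c = c' \<and> i = i'" by (simp add: doubleton_eq_iff)
    then show ?thesis using outer(3) cones2(3) by simp
  qed (use outer(1) in linarith)+
qed

lemma vx_notin_fan: "k < steps \<Longrightarrow> g < 6 \<Longrightarrow> g' < 8 \<Longrightarrow> g' \<notin> {g, g + 1, g + 2} \<Longrightarrow> vx g' i \<notin> fan g k"
  using fan_vertex[of k g "vx g' i"] vx_mod[of g' i] by auto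

lemma opens_not:
  assumes "opens e t"
  shows "\<not> {vx 7 0, vx 4 i, vx 5 k} \<subseteq> t" "\<not> {vx 6 c, vx 1 i, vx 2 k} \<subseteq> t"
  using assms by (cases rule: opens.cases; simp add: vx_notin_fan)+

lemma opens_key_pos:
  assumes "opens e t"
  shows "1 < key e"
  using assms
proof (cases rule: opens_by_key)
  case (fan0 k)
  then show ?thesis using key_rung0[of k] by simp
qed simp_all

lemma stage_codes:
  assumes "stage e a"
  shows "group_code e \<in> {3, 5, 24, 40, 130, 1, 8, 6, 17, 34, 10, 20, 80, 48, 129, 144, 160, 72, 66, 68}"
  using stage_group_code[OF assms] by (elim disjE exE conjE insertE; simp)

lemma vertex_cases: "\<exists>g<8. z = vx g (z div 8)"
  by (rule exI[of _ "z mod 8"]) (simp add: vx_def)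

text \<open>
  No triangle on a grid edge is complete before the cone at \<open>vx 7 0\<close> is built: among groups
  other than 7 only group 3 is joined to both group 4 and group 5, and at that time its
  single edge to them is the last rung of the second fan.
\<close>
lemma grid_triangle_late:
  assumes "z \<noteq> vx 4 i" "z \<noteq> vx 5 k"
  shows "steps + 2 < key {vx 4 i, z} \<or> steps + 2 < key {vx 5 k, z}"
proof (rule ccontr)
  assume "\<not> ?thesis"
  then have le: "key {vx 4 i, z} \<le> steps + 2" "key {vx 5 k, z} \<le> steps + 2" by simp_all
  have st: "stage {vx 4 i, z} (key {vx 4 i, z})" "stage {vx 5 k, z} (key {vx 5 k, z})"
    using le by (intro stage_key; simp)+
  obtain g where g: "g < 8" "z = vx g (z div 8)" using vertex_cases by blast
  have c: "group_code {vx 4 i, z} = (if g = 4 then 16 else 16 + 2 ^ g)"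
    "group_code {vx 5 k, z} = (if g = 5 then 32 else 32 + 2 ^ g)"
    using group_code_pair[of 4 g i "z div 8"] group_code_pair[of 5 g k "z div 8"] g by auto
  have "g = 0 \<or> g = 1 \<or> g = 2 \<or> g = 3 \<or> g = 4 \<or> g = 5 \<or> g = 6 \<or> g = 7"
    using g(1) by linarith
  then consider "g = 3" | "g = 7"
    using stage_codes[OF st(1)] stage_codes[OF st(2)] unfolding c by (elim disjE) simp_all
  then show False
  proof cases
    case 1
    obtain l where l: "l \<le> steps" "{vx 4 i, z} = rung 3 l"
      "key {vx 4 i, z} = (if l = steps then 0 else steps + 6 + (steps - l))"
      using stage_rung3[OF st(1)] 1 c by auto
    obtain l' where l': "l' \<le> steps" "{vx 5 k, z} = rung 3 l'"
      "key {vx 5 k, z} = (if l' = steps then 0 else steps + 6 + (steps - l'))"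
      using stage_rung3[OF st(2)] 1 c by auto
    have "l = steps" "l' = steps" using l(3) l'(3) le by (simp_all split: if_splits)
    then have "{vx 4 i, z} = {vx 5 k, z}" using l(2) l'(2) by simp
    then have "vx 4 i \<in> {vx 5 k, z}" by blast
    then show False using assms by auto
  next
    case 2
    then show False using stage_unique[OF st(1)] le(1) c(1) by simp
  qed
qed

lemma vx_7_notin_rung: "k \<le> steps \<Longrightarrow> vx 7 0 \<notin> rung 0 k" "k \<le> steps \<Longrightarrow> vx 7 0 \<notin> rung 3 k"
proof -
  assume k: "k \<le> steps"
  show "vx 7 0 \<notin> rung 0 k"
  proof (rule rung_pair[OF k shifts(1,2)])
    fix j i assume e: "rung 0 k = {vx 0 j, vx 1 i}"
    show ?thesis unfolding e by simp
  next
    fix j i assume e: "rung 0 k = {vx 0 j, vx 2 i}"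
    show ?thesis unfolding e by simp
  qed
  show "vx 7 0 \<notin> rung 3 k"
  proof (rule rung_pair[OF k shifts(3,4)])
    fix j i assume e: "rung 3 k = {vx 3 j, vx 4 i}"
    show ?thesis unfolding e by simp
  next
    fix j i assume e: "rung 3 k = {vx 3 j, vx 5 i}"
    show ?thesis unfolding e by simp
  qed
qed

lemma stage_at_7:
  assumes "stage {vx 7 0, z} a"
  obtains "z = vx 1 0" | "z = vx 0 0" | i where "i < 2 * h" "z = vx 4 i" | i where "i < 2 * h" "z = vx 5 i"
  using assms
proof (cases rule: stage.cases)
  case old
  from old(2) show ?thesis
    by (cases rule: old_edges.cases)
      (use that(1) vx_7_notin_rung[of steps] in \<open>auto simp: doubleton_eq_iff\<close>)
next
  case grid
  then obtain i k where "{vx 7 0, z} = {vx 4 i, vx 5 k}" unfolding grid_edges_def by blast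
  then show ?thesis by (simp add: doubleton_eq_iff)
next
  case (rung0 k)
  have "vx 7 0 \<in> rung 0 k" unfolding rung0(1)[symmetric] by simp
  then show ?thesis using vx_7_notin_rung(1)[of k] rung0 by simp
next
  case (rung3 k)
  have "vx 7 0 \<in> rung 3 k" unfolding rung3(1)[symmetric] by simp
  then show ?thesis using vx_7_notin_rung(2)[of k] rung3 by simp
qed (use that in \<open>auto simp: doubleton_eq_iff\<close>)

text \<open>
  When the cone at \<open>vx 7 0\<close> is complete, its apex has only the neighbours \<open>vx 0 0\<close>, \<open>vx 1 0\<close>
  and groups 4 and 5. So a triangle at the apex is a selected one or spans a grid edge.
\<close>
lemma cone_triangle:
  assumes z: "u \<noteq> z" and le: "key {vx 7 0, u} \<le> steps + 5" "key {vx 7 0, z} \<le> steps + 5" "key {u, z} \<le> steps + 5"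
  shows "(\<exists>e. opens e {vx 7 0, u, z}) \<or> (\<exists>p\<in>grid_edges. {vx 7 0, u, z} = insert (vx 7 0) p)"
proof -
  have st: "stage {vx 7 0, u} (key {vx 7 0, u})" "stage {vx 7 0, z} (key {vx 7 0, z})" "stage {u, z} (key {u, z})"
    using le by (intro stage_key; simp)+
  have codes: "group_code {u, z} \<in> {3, 5, 24, 40, 130, 1, 8, 6, 17, 34, 10, 20, 80, 48, 129, 144, 160, 72, 66, 68}"
    by (rule stage_codes[OF st(3)])
  have gr: "{vx 4 i, vx 5 k} \<in> grid_edges" if "i < 2 * h" "k < 2 * h" for i k
    using that unfolding grid_edges_def by blast
  have swap: "{a, b, c} = {a, c, b}" for a b c :: nat by auto
  note o = opens.cone0 opens.cone4 opens.cone5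
  show ?thesis
  proof (rule stage_at_7[OF st(1)]; rule stage_at_7[OF st(2)])
    fix i k assume *: "i < 2 * h" "u = vx 4 i" "k < 2 * h" "z = vx 5 k"
    show ?thesis using gr[OF *(1,3)] unfolding *(2,4) by (intro disjI2 bexI) auto
  next
    fix i k assume *: "k < 2 * h" "u = vx 5 k" "i < 2 * h" "z = vx 4 i"
    show ?thesis using gr[OF *(3,1)] unfolding *(2,4) by (intro disjI2 bexI) auto
  next
    assume *: "u = vx 1 0" "z = vx 0 0"
    show ?thesis using o(1) unfolding * swap[of _ "vx 1 0" "vx 0 0"] by (intro disjI1 exI)
  next
    assume *: "u = vx 0 0" "z = vx 1 0"
    show ?thesis using o(1) unfolding * by (intro disjI1 exI)
  next
    fix i assume *: "u = vx 0 0" "i < 2 * h" "z = vx 4 i"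
    show ?thesis using o(2)[OF *(2)] unfolding *(1,3) swap[of _ "vx 0 0" "vx 4 i"] by (intro disjI1 exI)
  next
    fix i assume *: "i < 2 * h" "u = vx 4 i" "z = vx 0 0"
    show ?thesis using o(2)[OF *(1)] unfolding *(2,3) by (intro disjI1 exI)
  next
    fix i assume *: "u = vx 1 0" "i < 2 * h" "z = vx 5 i"
    show ?thesis using o(3)[OF *(2)] unfolding *(1,3) swap[of _ "vx 1 0" "vx 5 i"] by (intro disjI1 exI)
  next
    fix i assume *: "i < 2 * h" "u = vx 5 i" "z = vx 1 0"
    show ?thesis using o(3)[OF *(1)] unfolding *(2,3) by (intro disjI1 exI)
  qed (use codes z in \<open>simp_all\<close>)
qed

lemma cone_stage:
  assumes "steps + 3 \<le> key e" "key e \<le> steps + 5"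
  shows "vx 7 0 \<in> e"
proof -
  have "stage e (key e)" using assms(2) by (intro stage_key) simp
  then show ?thesis using assms by (cases rule: stage.cases) auto
qed

end

section \<open>Filtrations from keys on edges\<close>

text \<open>
  Edges of equal key come in an arbitrary order.
\<close>
definition edge_sequence :: "nat \<Rightarrow> (nat set \<Rightarrow> nat) \<Rightarrow> nat set list" where
  "edge_sequence n key = sort_key key (SOME xs. set xs = edges_of (full_simplex n) \<and> distinct xs)"

definition triangle_sequence :: "nat \<Rightarrow> nat set list \<Rightarrow> nat set set \<Rightarrow> nat set list" where
  "triangle_sequence n es F = sort_key (\<lambda>t. 2 * last_edge es t + (if t \<in> F then 0 else 1))
     (SOME xs. set xs = triangles_of (full_simplex n) \<and> distinct xs)"

lemma finite_full_simplex: "finite (full_simplex n)"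
  by (rule finite_subset[of _ "Pow {..<n}"]) (auto simp: full_simplex_def)

lemma edge_sequence: "set (edge_sequence n key) = edges_of (full_simplex n)" "distinct (edge_sequence n key)"
proof -
  have "finite (edges_of (full_simplex n))" by (simp add: edges_of_def finite_full_simplex)
  from someI_ex[OF finite_distinct_list[OF this]]
  show "set (edge_sequence n key) = edges_of (full_simplex n)" "distinct (edge_sequence n key)"
    unfolding edge_sequence_def by simp_all
qed

lemma triangle_sequence: "set (triangle_sequence n es F) = triangles_of (full_simplex n)"
  "distinct (triangle_sequence n es F)"
proof -
  have "finite (triangles_of (full_simplex n))" by (simp add: triangles_of_def finite_full_simplex)
  from someI_ex[OF finite_distinct_list[OF this]]
  show "set (triangle_sequence n es F) = triangles_of (full_simplex n)" "distinct (triangle_sequence n es F)"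
    unfolding triangle_sequence_def by simp_all
qed

lemma filtration_step_full:
  assumes "set es = edges_of (full_simplex n)"
  shows "filtration_step n es (length es) = full_simplex n"
proof (rule subset_antisym)
  have ok: "set es \<subseteq> edges_of (full_simplex n)" using assms by simp
  show "filtration_step n es (length es) \<subseteq> full_simplex n"
    using clique_complex_greatest(1)[OF ok] by (simp add: filtration_step_def subcomplex_def)
  have "subcomplex (full_simplex n) (full_simplex n)"
    unfolding subcomplex_def full_simplex_def by blast
  then show "full_simplex n \<subseteq> filtration_step n es (length es)"
    using clique_complex_greatest(3)[OF ok] assms by (simp add: filtration_step_def)
qed

lemma clique_filtration_sequences:
  "clique_filtration n (edge_sequence n key) (triangle_sequence n (edge_sequence n key) F)"
proof
  let ?es = "edge_sequence n key"
  let ?ts = "triangle_sequence n ?es F"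
  let ?f = "\<lambda>t. 2 * last_edge ?es t + (if t \<in> F then 0 else 1)"
  have "sorted (map ?f ?ts)" unfolding triangle_sequence_def by simp
  then have "sorted_wrt (\<lambda>s t. ?f s \<le> ?f t) ?ts" by (simp add: sorted_wrt_map)
  then show "sorted_wrt (\<lambda>s t. last_edge ?es s \<le> last_edge ?es t) ?ts"
    by (rule sorted_wrt_mono_rel[rotated]) (simp split: if_splits)
qed (simp_all add: edge_sequence triangle_sequence filtration_step_full)

lemma position_sorted:
  assumes "distinct xs" "sorted (map f xs)" "x \<in> set xs" "y \<in> set xs" "position xs x \<le> position xs y"
  shows "f x \<le> f y"
proof -
  have "map f xs ! position xs x \<le> map f xs ! position xs y"
    using assms(2,5) position_less[OF assms(1,4)] by (intro sorted_nth_mono) auto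
  then show ?thesis
    using assms position_less nth_position by (metis nth_map)
qed

locale keyed_reduction =
  fixes n :: nat and key :: "nat set \<Rightarrow> nat" and F :: "nat set set"
    and es ts :: "nat set list" and R :: "nat set \<Rightarrow> nat set \<Rightarrow> bit" and U :: "nat set \<Rightarrow> nat set set"
  assumes es: "es = edge_sequence n key" and ts: "ts = triangle_sequence n es F"
    and red: "column_reduction (set ts) (set es) (position ts) (position es) (\<lambda>t e. of_bool (e \<subseteq> t)) R U"
begin

sublocale column_reduction "set ts" "set es" "position ts" "position es" "\<lambda>t e. of_bool (e \<subseteq> t)" R U
  by (rule red)

lemma distinct_es: "distinct es" and distinct_ts: "distinct ts"
  unfolding ts es by (rule edge_sequence triangle_sequence)+

lemma edge_iff: "e \<in> set es \<longleftrightarrow> (\<exists>x y. e = {x, y} \<and> x \<noteq> y \<and> x < n \<and> y < n)"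
proof -
  have "e \<in> set es \<longleftrightarrow> e \<subseteq> {..<n} \<and> card e = 2"
    unfolding es edge_sequence by (auto simp: edges_of_def full_simplex_def)
  then show ?thesis by (auto simp: card_2_iff)
qed

lemma edge_card: "e \<in> set es \<Longrightarrow> card e = 2"
  by (auto simp: edge_iff)

lemma triangle_iff:
  "t \<in> set ts \<longleftrightarrow> (\<exists>x y z. t = {x, y, z} \<and> distinct [x, y, z] \<and> x < n \<and> y < n \<and> z < n)"
proof -
  have "t \<in> set ts \<longleftrightarrow> t \<subseteq> {..<n} \<and> card t = 3"
    unfolding ts triangle_sequence by (auto simp: triangles_of_def full_simplex_def)
  then show ?thesis by (auto simp: card_3_iff)
qed

lemma edge_in: "x \<noteq> y \<Longrightarrow> x < n \<Longrightarrow> y < n \<Longrightarrow> {x, y} \<in> set es"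
  unfolding edge_iff by blast

lemma triangle_in: "distinct [x, y, z] \<Longrightarrow> x < n \<Longrightarrow> y < n \<Longrightarrow> z < n \<Longrightarrow> {x, y, z} \<in> set ts"
  unfolding triangle_iff by blast

lemma key_mono:
  assumes "e \<in> set es" "e' \<in> set es" "position es e \<le> position es e'"
  shows "key e \<le> key e'"
  by (rule position_sorted[OF distinct_es _ assms]) (simp add: es edge_sequence_def)

lemma key_less:
  assumes "e \<in> set es" "e' \<in> set es" "key e < key e'"
  shows "position es e < position es e'"
  using key_mono[OF assms(2,1)] assms(3) by (meson leD leI)

lemma triangle_order:
  assumes "s \<in> set ts" "t \<in> set ts" "position ts s \<le> position ts t"
  shows "2 * last_edge es s + (if s \<in> F then 0 else 1) \<le> 2 * last_edge es t + (if t \<in> F then 0 else 1)"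
  by (rule position_sorted[OF distinct_ts _ assms]) (simp add: ts triangle_sequence_def)

lemma triangle_less:
  assumes "s \<in> set ts" "t \<in> set ts"
    "last_edge es s < last_edge es t \<or> last_edge es s = last_edge es t \<and> s \<in> F \<and> t \<notin> F"
  shows "position ts s < position ts t"
proof (rule ccontr)
  assume "\<not> ?thesis"
  then have "position ts t \<le> position ts s" by simp
  from triangle_order[OF assms(2,1) this] assms(3) show False
    by (elim disjE) (simp_all split: if_splits)
qed

lemma last_edge_mono:
  assumes "s \<in> set ts" "t \<in> set ts" "position ts s < position ts t"
  shows "last_edge es s \<le> last_edge es t"
  using triangle_order[OF assms(1,2)] assms(3) by (simp split: if_splits)

lemma last_edge_upper:
  assumes "e \<in> set es" "e \<subseteq> t"
  shows "position es e \<le> last_edge es t"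
  unfolding last_edge_def
  using assms position_less[OF distinct_es assms(1)] nth_position[OF distinct_es assms(1)]
  by (intro Max_ge) auto

lemma last_edge_attained:
  assumes "t \<in> set ts"
  obtains e where "e \<in> set es" "e \<subseteq> t" "position es e = last_edge es t"
proof -
  obtain x y z where t: "t = {x, y, z}" "distinct [x, y, z]" "x < n" "y < n" "z < n"
    using assms[unfolded triangle_iff] by (elim exE conjE)
  then have xy: "{x, y} \<in> set es" by (intro edge_in) simp_all
  let ?I = "{i. i < length es \<and> es ! i \<subseteq> t}"
  have "position es {x, y} \<in> ?I"
    using position_less[OF distinct_es xy] nth_position[OF distinct_es xy] t(1) by simp
  then have "Max ?I \<in> ?I" by (intro Max_in) auto
  then have "last_edge es t < length es" "es ! last_edge es t \<subseteq> t" by (simp_all add: last_edge_def)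
  then show ?thesis using that[of "es ! last_edge es t"] distinct_es by simp
qed

lemma edge_in_triple:
  assumes "card e = 2"
  shows "e \<subseteq> {x, y, z} \<longleftrightarrow> distinct [x, y] \<and> e = {x, y} \<or> distinct [y, z] \<and> e = {y, z} \<or> distinct [x, z] \<and> e = {x, z}"
proof -
  obtain a b where "e = {a, b}" "a \<noteq> b" using assms by (auto simp: card_2_iff)
  then show ?thesis by (auto simp: doubleton_eq_iff)
qed

lemma last_edge_eq:
  assumes "distinct [x, y, z]" "x < n" "y < n" "z < n" "key {x, z} < key {x, y}" "key {y, z} < key {x, y}"
  shows "last_edge es {x, y, z} = position es {x, y}"
proof -
  have t: "{x, y, z} \<in> set ts" by (rule triangle_in[OF assms(1-4)])
  have E: "{x, y} \<in> set es" "{x, z} \<in> set es" "{y, z} \<in> set es"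
    using assms(1-4) by (auto intro!: edge_in)
  obtain e where e: "e \<in> set es" "e \<subseteq> {x, y, z}" "position es e = last_edge es {x, y, z}"
    by (rule last_edge_attained[OF t])
  have le: "position es {x, y} \<le> position es e"
    unfolding e(3) by (rule last_edge_upper[OF E(1)]) simp
  from e(2) have "e = {x, y} \<or> e = {y, z} \<or> e = {x, z}"
    unfolding edge_in_triple[OF edge_card[OF e(1)]] by (elim disjE conjE) simp_all
  then have "e = {x, y}"
  proof (elim disjE)
    assume "e = {y, z}"
    then show ?thesis using key_less[OF E(3,1) assms(6)] le by simp
  next
    assume "e = {x, z}"
    then show ?thesis using key_less[OF E(2,1) assms(5)] le by simp
  qed
  then show ?thesis using e(3) by simp
qed

text \<open>
  Only earlier columns are added, and these involve no later edges.
\<close>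
lemma support_le_last_edge:
  assumes "s \<in> set ts" "e \<in> set es" "R s e \<noteq> 0"
  shows "position es e \<le> last_edge es s"
  using assms
proof (induction "position ts s" arbitrary: s rule: less_induct)
  case less
  show ?case
  proof (cases "e \<subseteq> s")
    case True
    then show ?thesis by (rule last_edge_upper[OF less.prems(2)])
  next
    case False
    then have "(\<Sum>t\<in>U s. R t e) \<noteq> 0" using reduced_eq[OF less.prems(1,2)] less.prems(3) by simp
    then obtain t where t: "t \<in> U s" "R t e \<noteq> 0" by (meson sum.neutral)
    note a = added_earlier[OF less.prems(1) t(1)]
    have "position es e \<le> last_edge es t" using less.hyps[of t] a less.prems(2) t(2) by blast
    also have "\<dots> \<le> last_edge es s" using last_edge_mono a less.prems(1) by blast
    finally show ?thesis .
  qed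
qed

text \<open>
  The first triangle at its last edge is left alone: every earlier column is supported on
  earlier edges, so none has this pivot.
\<close>
lemma opening_column:
  assumes s: "s \<in> set ts" "s \<in> F" and e: "e \<in> set es" "e \<subseteq> s" "last_edge es s = position es e"
    and unique: "\<And>t. t \<in> set ts \<Longrightarrow> t \<in> F \<Longrightarrow> last_edge es t = position es e \<Longrightarrow> t = s"
  shows "a \<in> set es \<Longrightarrow> R s a = of_bool (a \<subseteq> s)" and "piv s e"
proof -
  have top: "pivot (set es) (position es) (\<lambda>a. of_bool (a \<subseteq> s)) e"
    unfolding pivot_def
  proof (intro conjI ballI impI)
    show "e \<in> set es" by (rule e)
    show "(of_bool (e \<subseteq> s) :: bit) \<noteq> 0" using e(2) by simp
    fix a assume "a \<in> set es" "(of_bool (a \<subseteq> s) :: bit) \<noteq> 0"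
    then show "position es a \<le> position es e"
      using last_edge_upper[of a s] e(3) by (cases "a \<subseteq> s") simp_all
  qed
  have "U s = {}"
  proof (rule reduced_eq_by_added[OF s(1), where p = e])
    show "pivot (set es) (position es) (\<lambda>a. of_bool (a \<subseteq> s) + (\<Sum>t\<in>{}. R t a)) e"
      using top by simp
    fix t assume t: "t \<in> set ts" "position ts t < position ts s"
    show "\<not> piv t e"
    proof
      assume p: "piv t e"
      have "position es e \<le> last_edge es t"
        using support_le_last_edge[OF t(1)] pivotD(1,2)[OF p] by blast
      then have eq: "last_edge es t = position es e"
        using last_edge_mono[OF t(1) s(1) t(2)] e(3) by simp
      then have "t \<noteq> s \<Longrightarrow> t \<notin> F" using unique t(1) by blast
      then have "t \<noteq> s \<Longrightarrow> position ts s < position ts t"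
        using triangle_less[OF s(1) t(1)] s(2) eq e(3) by simp
      then show False using t(2) by auto
    qed
  qed blast
  then have R: "R s a = of_bool (a \<subseteq> s)" if "a \<in> set es" for a
    using reduced_eq[OF s(1) that] by simp
  then show "a \<in> set es \<Longrightarrow> R s a = of_bool (a \<subseteq> s)" .
  show "piv s e" using top unfolding pivot_def using R by simp
qed

end

section \<open>Dense reduced columns\<close>

locale nested_fans_reduction =
  nested_fans h + keyed_reduction n "nested_fans.key h" "{t. \<exists>e. nested_fans.opens h e t}" es ts R U
  for h n es ts R U +
  assumes size: "16 * h \<le> n"
begin

lemma opens_in:
  assumes "opens e t"
  shows "t \<in> set ts" "e \<in> set es" "e \<subseteq> t" "last_edge es t = position es e"
proof -
  obtain x y z where s: "t = {x, y, z}" "e = {x, y}" "distinct [x, y, z]" "{x, y, z} \<subseteq> {..<16 * h}"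
    "key {x, z} < key e" "key {y, z} < key e"
    by (rule opens_shape[OF assms])
  have lt: "x < n" "y < n" "z < n" using s(4) size by auto
  show "t \<in> set ts" unfolding s(1) by (rule triangle_in[OF s(3) lt])
  show "e \<in> set es" unfolding s(2) using s(3) lt by (intro edge_in) simp_all
  show "e \<subseteq> t" unfolding s by blast
  show "last_edge es t = position es e"
    unfolding s(1,2) by (rule last_edge_eq[OF s(3) lt s(5,6)[unfolded s(2)]])
qed

lemma opens_column:
  assumes "opens e t"
  shows "a \<in> set es \<Longrightarrow> R t a = of_bool (a \<subseteq> t)" and "piv t e"
proof -
  have F: "t \<in> {t. \<exists>e. opens e t}" using assms by blast
  have u: "t' = t" if t': "t' \<in> {t. \<exists>e. opens e t}" "last_edge es t' = position es e" for t'
  proof -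
    obtain e' where e': "opens e' t'" using t'(1) by blast
    have "position es e' = position es e" using t'(2) opens_in(4)[OF e'] by simp
    then have "e' = e"
      using inj_onD[OF inj_row_position] opens_in(2)[OF e'] opens_in(2)[OF assms] by blast
    then show ?thesis using opens_functional e' assms by blast
  qed
  note oc = opening_column[OF opens_in(1)[OF assms] F opens_in(2-4)[OF assms] u]
  show "a \<in> set es \<Longrightarrow> R t a = of_bool (a \<subseteq> t)" by (rule oc(1))
  show "piv t e" by (rule oc(2))
qed

lemma opens_earlier:
  assumes "opens e t" "s \<in> set ts" "last_edge es s = position es e'" "e' \<in> set es"
    and "key e < key e' \<or> e = e' \<and> (\<nexists>e. opens e s)"
  shows "position ts t < position ts s"
proof (rule triangle_less[OF opens_in(1)[OF assms(1)] assms(2)])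
  show "last_edge es t < last_edge es s \<or>
      last_edge es t = last_edge es s \<and> t \<in> {t. \<exists>e. opens e t} \<and> s \<notin> {t. \<exists>e. opens e t}"
    using assms(5)
  proof (elim disjE conjE)
    assume "key e < key e'"
    then show ?thesis
      using key_less[OF opens_in(2)[OF assms(1)] assms(4)] opens_in(4)[OF assms(1)] assms(3) by simp
  next
    assume "e = e'" "\<nexists>e. opens e s"
    then show ?thesis using opens_in(4)[OF assms(1)] assms(1,3) by auto
  qed
qed

lemma vx_n: "g < 8 \<Longrightarrow> i < 2 * h \<Longrightarrow> vx g i < n"
  by (rule vx_less[OF _ _ size])

definition ind :: "nat set \<Rightarrow> nat set \<Rightarrow> bit" where
  "ind a b = of_bool (a = b)"

lemma boundary_triple:
  assumes "a \<in> set es" "distinct [x, y, z]"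
  shows "of_bool (a \<subseteq> {x, y, z}) = ind a {x, y} + ind a {y, z} + ind a {x, z}"
proof -
  have ne: "{x, y} \<noteq> {y, z}" "{x, y} \<noteq> {x, z}" "{y, z} \<noteq> {x, z}"
    using assms(2) by (simp_all add: doubleton_eq_iff)
  have "a \<subseteq> {x, y, z} \<longleftrightarrow> a = {x, y} \<or> a = {y, z} \<or> a = {x, z}"
    unfolding edge_in_triple[OF edge_card[OF assms(1)]] using assms(2) by simp
  then show ?thesis unfolding ind_def using ne by (cases "a = {x, y}"; cases "a = {y, z}"; cases "a = {x, z}") simp_all
qed

text \<open>
  The shape of the boundary behind the telescoping: two consecutive rungs and a residue.
\<close>
lemma boundary_fan:
  assumes "a \<in> set es" "k < steps" "g < 6"
  shows "of_bool (a \<subseteq> fan g k) = ind a (rung g k) + ind a (rung g (Suc k)) + ind a (residue g k)"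
proof -
  obtain x y z where s: "fan g k = {x, y, z}" "rung g k = {x, y}" "distinct [x, y, z]"
    "{{x, z}, {y, z}} = {rung g (Suc k), residue g k}"
    by (rule fan_shape[OF assms(2,3)])
  have "{x, z} = rung g (Suc k) \<and> {y, z} = residue g k \<or> {x, z} = residue g k \<and> {y, z} = rung g (Suc k)"
    by (rule iffD1[OF doubleton_eq_iff s(4)])
  then have "ind a {y, z} + ind a {x, z} = ind a (rung g (Suc k)) + ind a (residue g k)"
    by (elim disjE conjE) (simp_all only: add.commute)
  then show ?thesis
    unfolding s(1,2) boundary_triple[OF assms(1) s(3)] by (simp only: add.assoc)
qed

text \<open>
  Each inner rung occurs in two consecutive triangles, so adding up a fan trades its first
  rung for the last one and all residues.
\<close>
lemma fan_telescope:
  assumes "a \<in> set es" "g < 6" "K \<le> steps"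
  shows "(\<Sum>k<K. of_bool (a \<subseteq> fan g k)) = ind a (rung g 0) + ind a (rung g K) + (\<Sum>k<K. ind a (residue g k))"
  using assms(3)
proof (induction K)
  case 0
  then show ?case by simp
next
  case (Suc K)
  have K: "K < steps" using Suc.prems by simp
  show ?case
    unfolding sum.lessThan_Suc Suc.IH[OF less_imp_le[OF K]] boundary_fan[OF assms(1) K assms(2)]
    by (simp add: ac_simps)
qed

lemma opens_fan: "k < steps \<Longrightarrow> opens (rung 0 k) (fan 0 k)" "k < steps \<Longrightarrow> opens (rung 3 k) (fan 3 k)"
  by (rule opens.fan0, assumption) (rule opens.fan3)

lemma sum_fans:
  assumes a: "a \<in> set es" and g: "g < 6" and opens: "\<And>k. k < steps \<Longrightarrow> opens (rung g k) (fan g k)"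
  shows "(\<Sum>t\<in>fan g ` {..<steps}. R t a) =
    ind a (rung g 0) + ind a (rung g steps) + (\<Sum>k<steps. ind a (residue g k))"
proof -
  have "inj_on (fan g) {..<steps}"
  proof (rule inj_onI)
    fix k k' assume *: "k \<in> {..<steps}" "k' \<in> {..<steps}" "fan g k = fan g k'"
    then have o: "opens (rung g k) (fan g k)" "opens (rung g k') (fan g k)"
      using opens[of k] opens[of k'] by simp_all
    have "position es (rung g k) = position es (rung g k')"
      using opens_in(4)[OF o(1)] opens_in(4)[OF o(2)] by simp
    then have "rung g k = rung g k'"
      using inj_onD[OF inj_row_position] opens_in(2)[OF o(1)] opens_in(2)[OF o(2)] by blast
    then show "k = k'" using * g rung_inj[of k k' g] by simp
  qed
  then have "(\<Sum>t\<in>fan g ` {..<steps}. R t a) = (\<Sum>k<steps. R (fan g k) a)"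
    by (simp add: sum.reindex)
  also have "\<dots> = (\<Sum>k<steps. of_bool (a \<subseteq> fan g k))"
    using opens_column(1)[OF opens a] by (intro sum.cong) simp_all
  also have "\<dots> = ind a (rung g 0) + ind a (rung g steps) + (\<Sum>k<steps. ind a (residue g k))"
    by (rule fan_telescope[OF a g order_refl])
  finally show ?thesis .
qed

lemma ind_old: "a \<notin> old_edges \<Longrightarrow> b \<in> old_edges \<Longrightarrow> ind a b = 0"
  unfolding ind_def by auto

definition grid_column :: "nat \<Rightarrow> nat \<Rightarrow> nat set" where
  "grid_column i k = {vx 7 0, vx 4 i, vx 5 k}"

text \<open>
  The columns added to that of the triangle on a grid edge and \<open>vx 7 0\<close>: three triangles of
  the cone move the grid edge to the first rung of the first fan, and the whole fan then
  spreads this rung over its residues.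
\<close>
definition grid_reducers :: "nat \<Rightarrow> nat \<Rightarrow> nat set set" where
  "grid_reducers i k = insert {vx 7 0, vx 4 i, vx 0 0} (insert {vx 7 0, vx 5 k, vx 1 0}
     (insert {vx 7 0, vx 0 0, vx 1 0} (fan 0 ` {..<steps})))"

definition grid_result :: "nat \<Rightarrow> nat \<Rightarrow> nat set \<Rightarrow> bit" where
  "grid_result i k a = ind a {vx 4 i, vx 5 k} + ind a {vx 0 0, vx 4 i} + ind a {vx 1 0, vx 5 k}
     + ind a (rung 0 steps) + (\<Sum>l<steps. ind a (residue 0 l))"

lemma grid_edge_in: "i < 2 * h \<Longrightarrow> k < 2 * h \<Longrightarrow> {vx 4 i, vx 5 k} \<in> set es"
  by (intro edge_in vx_n) simp_all

lemma grid_in: "i < 2 * h \<Longrightarrow> k < 2 * h \<Longrightarrow> {vx 4 i, vx 5 k} \<in> grid_edges"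
  unfolding grid_edges_def by blast

lemma key_grid_edge: "i < 2 * h \<Longrightarrow> k < 2 * h \<Longrightarrow> key {vx 4 i, vx 5 k} = 1"
  by (rule key_grid[OF grid_in])

lemma grid_column_in:
  assumes "i < 2 * h" "k < 2 * h"
  shows "grid_column i k \<in> set ts" "last_edge es (grid_column i k) = position es {vx 7 0, vx 5 k}"
    "{vx 7 0, vx 5 k} \<in> set es" "\<nexists>e. opens e (grid_column i k)"
proof -
  have lt: "vx 7 0 < n" "vx 5 k < n" "vx 4 i < n" using assms by (intro vx_n; simp)+
  have d: "distinct [vx 7 0, vx 5 k, vx 4 i]" by simp
  have eq: "grid_column i k = {vx 7 0, vx 5 k, vx 4 i}" unfolding grid_column_def by blast
  have k: "key {vx 7 0, vx 4 i} < key {vx 7 0, vx 5 k}" "key {vx 5 k, vx 4 i} < key {vx 7 0, vx 5 k}"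
    using key_cone4[OF assms(1)] key_cone5[OF assms(2)] key_grid_edge[OF assms]
    by (simp_all add: insert_commute)
  show "grid_column i k \<in> set ts" unfolding eq by (rule triangle_in[OF d lt])
  show "last_edge es (grid_column i k) = position es {vx 7 0, vx 5 k}"
    unfolding eq by (rule last_edge_eq[OF d lt k])
  show "{vx 7 0, vx 5 k} \<in> set es" using lt by (intro edge_in) simp_all
  show "\<nexists>e. opens e (grid_column i k)" using opens_not(1) unfolding grid_column_def by blast
qed

lemma grid_combination:
  assumes a: "a \<in> set es" and ik: "i < 2 * h" "k < 2 * h"
  shows "of_bool (a \<subseteq> grid_column i k) + (\<Sum>t\<in>grid_reducers i k. R t a) = grid_result i k a"
proof -
  let ?t1 = "{vx 7 0, vx 4 i, vx 0 0}" and ?t2 = "{vx 7 0, vx 5 k, vx 1 0}" and ?t3 = "{vx 7 0, vx 0 0, vx 1 0}"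
  have nf: "t \<notin> fan 0 ` {..<steps}" if "vx 7 0 \<in> t" for t
    using that vx_notin_fan[of _ 0 7 0] by auto
  have "vx 4 i \<notin> ?t2" "vx 4 i \<notin> ?t3" "vx 5 k \<notin> ?t3" by simp_all
  then have d: "?t1 \<noteq> ?t2" "?t1 \<noteq> ?t3" "?t2 \<noteq> ?t3" by blast+
  have n: "?t1 \<notin> insert ?t2 (insert ?t3 (fan 0 ` {..<steps}))" "?t2 \<notin> insert ?t3 (fan 0 ` {..<steps})"
    "?t3 \<notin> fan 0 ` {..<steps}"
    using nf[of ?t1] nf[of ?t2] nf[of ?t3] d by blast+
  have "(\<Sum>t\<in>grid_reducers i k. R t a) = R ?t1 a + (R ?t2 a + (R ?t3 a + (\<Sum>t\<in>fan 0 ` {..<steps}. R t a)))"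
    unfolding grid_reducers_def using n by simp
  moreover have "R ?t1 a = ind a {vx 7 0, vx 4 i} + ind a {vx 4 i, vx 0 0} + ind a {vx 7 0, vx 0 0}"
    unfolding opens_column(1)[OF opens.cone4[OF ik(1)] a] by (rule boundary_triple[OF a]) simp
  moreover have "R ?t2 a = ind a {vx 7 0, vx 5 k} + ind a {vx 5 k, vx 1 0} + ind a {vx 7 0, vx 1 0}"
    unfolding opens_column(1)[OF opens.cone5[OF ik(2)] a] by (rule boundary_triple[OF a]) simp
  moreover have "R ?t3 a = ind a {vx 7 0, vx 0 0} + ind a {vx 0 0, vx 1 0} + ind a {vx 7 0, vx 1 0}"
    unfolding opens_column(1)[OF opens.cone0 a] by (rule boundary_triple[OF a]) simp
  moreover have "of_bool (a \<subseteq> grid_column i k) =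
      ind a {vx 7 0, vx 4 i} + ind a {vx 4 i, vx 5 k} + ind a {vx 7 0, vx 5 k}"
    unfolding grid_column_def by (rule boundary_triple[OF a]) simp
  moreover have "(\<Sum>t\<in>fan 0 ` {..<steps}. R t a) =
      ind a {vx 0 0, vx 1 0} + ind a (rung 0 steps) + (\<Sum>k<steps. ind a (residue 0 k))"
    unfolding rung_0_0[symmetric] by (rule sum_fans[OF a]) (simp_all add: opens_fan)
  moreover have "{vx 4 i, vx 0 0} = {vx 0 0, vx 4 i}" "{vx 5 k, vx 1 0} = {vx 1 0, vx 5 k}" by blast+
  ultimately show ?thesis by (simp only: grid_result_def ac_simps bit_add_cancel bit_add_self add_0_left add_0_right)
qed

text \<open>
  All terms of \<open>grid_result\<close> other than the grid edge itself are old.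
\<close>
lemma grid_result_young:
  assumes "a \<notin> old_edges" "i < 2 * h" "k < 2 * h"
  shows "grid_result i k a = ind a {vx 4 i, vx 5 k}"
proof -
  have "(\<Sum>l<steps. ind a (residue 0 l)) = 0"
    using ind_old[OF assms(1) residue_0_old] by (intro sum.neutral) simp
  then show ?thesis
    using ind_old[OF assms(1) old_edges.star04[OF assms(2)]] ind_old[OF assms(1) old_edges.star15[OF assms(3)]]
      ind_old[OF assms(1) old_edges.last0] by (simp only: grid_result_def add_0_right)
qed

lemma pivot_grid_result:
  assumes ik: "i < 2 * h" "k < 2 * h"
    and v: "\<And>a. a \<in> set es \<Longrightarrow> v a = grid_result i k a"
  shows "pivot (set es) (position es) v {vx 4 i, vx 5 k}"
  unfolding pivot_def
proof (intro conjI ballI impI)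
  let ?p = "{vx 4 i, vx 5 k}"
  show p: "?p \<in> set es" by (rule grid_edge_in[OF ik])
  have "?p \<notin> old_edges" using key_grid_edge[OF ik] key_0_iff[of ?p] by simp
  then show "v ?p \<noteq> 0" using v[OF p] grid_result_young[OF _ ik] by (simp add: ind_def)
  fix a assume a: "a \<in> set es" "v a \<noteq> 0"
  show "position es a \<le> position es ?p"
  proof (cases "a \<in> old_edges")
    case True
    then have "key a < key ?p" using key_old key_grid_edge[OF ik] by simp
    then show ?thesis using key_less[OF a(1) p] by simp
  next
    case False
    then have "ind a ?p \<noteq> 0" using a v[OF a(1)] grid_result_young[OF _ ik] by simp
    then have "a = ?p" by (cases "a = ?p") (simp_all add: ind_def)
    then show ?thesis by simp
  qed
qed

text \<open>
  Before the cone at \<open>vx 7 0\<close> no boundary contains a grid edge, hence no sum of reduced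
  columns does either.
\<close>
lemma no_grid_entry:
  assumes "t \<in> set ts" "\<And>a. a \<in> set es \<Longrightarrow> a \<subseteq> t \<Longrightarrow> key a \<le> steps + 2" "i < 2 * h" "k < 2 * h"
  shows "R t {vx 4 i, vx 5 k} = 0"
  using assms(1,2)
proof (induction "position ts t" arbitrary: t rule: less_induct)
  case less
  let ?p = "{vx 4 i, vx 5 k}"
  have "\<not> ?p \<subseteq> t"
  proof
    assume p: "?p \<subseteq> t"
    obtain x y z where t: "t = {x, y, z}" "distinct [x, y, z]" "x < n" "y < n" "z < n"
      using less.prems(1)[unfolded triangle_iff] by (elim exE conjE)
    have "card t = 3" using t(1,2) by simp
    moreover have "card ?p = 2" by simp
    ultimately have "t \<noteq> ?p" by (metis numeral_eq_iff semiring_norm(89))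
    then obtain w where w: "w \<in> t" "w \<noteq> vx 4 i" "w \<noteq> vx 5 k" using p by blast
    have wn: "w < n" using w(1) t by auto
    have "{vx 4 i, w} \<in> set es" "{vx 5 k, w} \<in> set es"
      using w wn assms(3,4) by (auto intro!: edge_in vx_n)
    moreover have "{vx 4 i, w} \<subseteq> t" "{vx 5 k, w} \<subseteq> t" using p w by auto
    ultimately have "key {vx 4 i, w} \<le> steps + 2" "key {vx 5 k, w} \<le> steps + 2"
      using less.prems(2) by blast+
    then show False using grid_triangle_late[OF w(2,3)] by linarith
  qed
  moreover have "(\<Sum>u\<in>U t. R u ?p) = 0"
  proof (rule sum.neutral, rule ballI)
    fix u assume u: "u \<in> U t"
    note e = added_earlier[OF less.prems(1) u]
    obtain b where b: "b \<in> set es" "b \<subseteq> t" "position es b = last_edge es t"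
      by (rule last_edge_attained[OF less.prems(1)])
    show "R u ?p = 0"
    proof (rule less.hyps)
      fix a assume a: "a \<in> set es" "a \<subseteq> u"
      have "position es a \<le> position es b"
        using last_edge_upper[OF a] last_edge_mono[of u t] e less.prems(1) b(3) by simp
      then have "key a \<le> key b" by (rule key_mono[OF a(1) b(1)])
      then show "key a \<le> steps + 2" using less.prems(2)[OF b(1,2)] by simp
    qed (use e in simp_all)
  qed
  ultimately show ?case
    using reduced_eq[OF less.prems(1) grid_edge_in[OF assms(3,4)]] by simp
qed

lemma grid_reducer_opens:
  assumes "t \<in> grid_reducers i k" "i < 2 * h" "k < 2 * h"
  obtains e where "opens e t" "key e < steps + 5 \<or> e = {vx 7 0, vx 5 k}"
proof -
  consider "t = {vx 7 0, vx 4 i, vx 0 0}" | "t = {vx 7 0, vx 5 k, vx 1 0}" | "t = {vx 7 0, vx 0 0, vx 1 0}"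
    | l where "l < steps" "t = fan 0 l"
    using assms(1) unfolding grid_reducers_def by blast
  then show ?thesis
  proof cases
    case 1
    show ?thesis by (rule that[OF opens.cone4[OF assms(2), folded 1]]) (simp add: key_cone4 assms(2))
  next
    case 2
    show ?thesis by (rule that[OF opens.cone5[OF assms(3), folded 2]]) simp
  next
    case 3
    show ?thesis by (rule that[OF opens.cone0[folded 3]]) (simp add: key_cone0)
  next
    case (4 l)
    show ?thesis by (rule that[OF opens.fan0[OF 4(1), folded 4(2)]]) (rule disjI1, use key_rung0[OF 4(1)] in linarith)
  qed
qed

text \<open>
  By induction along the columns, because the row of the grid edge must not yet be a pivot.
  Columns that precede the cone have no entry in grid rows; selected columns have their
  designated edge as pivot; and any other column of the cone belongs to a grid edge of its
  own, which by the induction hypothesis is its pivot.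
\<close>
lemma grid_column_added:
  assumes "i < 2 * h" "k < 2 * h"
  shows "U (grid_column i k) = grid_reducers i k"
  using assms
proof (induction "position ts (grid_column i k)" arbitrary: i k rule: less_induct)
  case less
  note ik = less.prems
  let ?s = "grid_column i k" and ?p = "{vx 4 i, vx 5 k}" and ?top = "{vx 7 0, vx 5 k}"
  note s = grid_column_in[OF ik]
  have p: "?p \<in> set es" by (rule grid_edge_in[OF ik])
  have top: "key ?top = steps + 5" by (rule key_cone5[OF ik(2)])
  show ?case
  proof (rule reduced_eq_by_added[OF s(1), where p = ?p])
    fix t assume "t \<in> grid_reducers i k"
    then obtain e where e: "opens e t" "key e < steps + 5 \<or> e = ?top"
      by (rule grid_reducer_opens[OF _ ik])
    have "key e < key ?top \<or> e = ?top \<and> (\<nexists>e. opens e ?s)" using e(2) top s(4) by auto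
    then have "position ts t < position ts ?s"
      by (rule opens_earlier[OF e(1) s(1-3)])
    moreover have "key ?p < key e" using opens_key_pos[OF e(1)] key_grid_edge[OF ik] by simp
    then have "position es ?p < position es e" by (rule key_less[OF p opens_in(2)[OF e(1)]])
    ultimately show "t \<in> set ts \<and> position ts t < position ts ?s \<and> (\<exists>q. piv t q \<and> position es ?p < position es q)"
      using opens_in(1)[OF e(1)] opens_column(2)[OF e(1)] by blast
  next
    show "pivot (set es) (position es) (\<lambda>a. of_bool (a \<subseteq> ?s) + (\<Sum>t\<in>grid_reducers i k. R t a)) ?p"
      by (rule pivot_grid_result[OF ik]) (rule grid_combination[OF _ ik])
  next
    fix t assume t: "t \<in> set ts" "position ts t < position ts ?s"
    show "\<not> piv t ?p"
    proof
      assume piv: "piv t ?p"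
      have bound: "key a \<le> steps + 5" if a: "a \<in> set es" "a \<subseteq> t" for a
      proof -
        have "position es a \<le> position es ?top"
          using last_edge_upper[OF a] last_edge_mono[OF t(1) s(1) t(2)] s(2) by simp
        then show ?thesis using key_mono[OF a(1) s(3)] top by simp
      qed
      \<comment> \<open>Having an entry at a grid edge, \<open>t\<close> cannot be complete before the cone at \<open>vx 7 0\<close> begins.\<close>
      obtain a where a: "a \<in> set es" "a \<subseteq> t" "steps + 3 \<le> key a"
      proof (rule ccontr)
        assume "\<not> thesis"
        then have "key a \<le> steps + 2" if "a \<in> set es" "a \<subseteq> t" for a
          using that \<open>\<And>a. \<lbrakk>a \<in> set es; a \<subseteq> t; steps + 3 \<le> key a\<rbrakk> \<Longrightarrow> thesis\<close> by fastforce
        then have "R t ?p = 0" by (intro no_grid_entry[OF t(1)] ik)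
        then show False using pivotD(2)[OF piv] by simp
      qed
      have "vx 7 0 \<in> t" using cone_stage[OF a(3) bound[OF a(1,2)]] a(2) by blast
      moreover obtain x y z where xyz: "t = {x, y, z}" "distinct [x, y, z]" "x < n" "y < n" "z < n"
        using t(1)[unfolded triangle_iff] by (elim exE conjE)
      ultimately obtain u w where uw: "t = {vx 7 0, u, w}" "distinct [vx 7 0, u, w]" "u < n" "w < n" "vx 7 0 < n"
      proof -
        have "vx 7 0 = x \<or> vx 7 0 = y \<or> vx 7 0 = z" using \<open>vx 7 0 \<in> t\<close> xyz(1) by simp
        then show thesis
        proof (elim disjE)
          assume "vx 7 0 = x"
          then show thesis using xyz by (intro that[of y z]) auto
        next
          assume "vx 7 0 = y"
          then show thesis using xyz by (intro that[of x z]) auto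
        next
          assume "vx 7 0 = z"
          then show thesis using xyz by (intro that[of x y]) auto
        qed
      qed
      have "{vx 7 0, u} \<in> set es" "{vx 7 0, w} \<in> set es" "{u, w} \<in> set es"
        using uw(2-) by (simp_all add: edge_in)
      then have "key {vx 7 0, u} \<le> steps + 5" "key {vx 7 0, w} \<le> steps + 5" "key {u, w} \<le> steps + 5"
        using bound uw(1) by simp_all
      then have "(\<exists>e. opens e t) \<or> (\<exists>q\<in>grid_edges. t = insert (vx 7 0) q)"
        unfolding uw(1) using uw(2) by (intro cone_triangle) simp_all
      then show False
      proof (elim disjE exE bexE)
        fix e assume e: "opens e t"
        have "?p = e" by (rule pivot_unique[OF piv opens_column(2)[OF e]])
        then show False using opens_key_pos[OF e] key_grid_edge[OF ik] by simp
      next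
        fix q assume q: "q \<in> grid_edges" "t = insert (vx 7 0) q"
        then obtain i' k' where ik': "i' < 2 * h" "k' < 2 * h" "q = {vx 4 i', vx 5 k'}"
          unfolding grid_edges_def by blast
        have t': "t = grid_column i' k'" unfolding q(2) ik'(3) grid_column_def ..
        have "U (grid_column i' k') = grid_reducers i' k'"
          using less.hyps[of i' k'] t(2) ik'(1,2) unfolding t' by blast
        then have "R t a = grid_result i' k' a" if "a \<in> set es" for a
          using reduced_eq[OF t(1) that] grid_combination[OF that ik'(1,2)] unfolding t' by simp
        then have "piv t {vx 4 i', vx 5 k'}" by (rule pivot_grid_result[OF ik'(1,2)])
        then have "?p = {vx 4 i', vx 5 k'}" by (rule pivot_unique[OF piv])
        then have "t = ?s" unfolding t' grid_column_def by simp
        then show False using t(2) by simp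
      qed
    qed
  qed
qed

lemma grid_column_reduced:
  assumes "i < 2 * h" "k < 2 * h" "a \<in> set es"
  shows "R (grid_column i k) a = grid_result i k a"
  using reduced_eq[OF grid_column_in(1)[OF assms(1,2)] assms(3)] grid_combination[OF assms(3,1,2)]
  by (simp add: grid_column_added[OF assms(1,2)])

lemma group_code_residue_fan: "k \<in> fan_steps \<Longrightarrow> group_code (residue 0 k) = 6"
proof -
  assume k: "k \<in> fan_steps"
  obtain i i' where r: "residue 0 k = {vx 1 i, vx 2 i'}"
    by (rule residue_bounds[OF k shifts(1,2)])
  show ?thesis unfolding r by simp
qed

lemma group_code_residue_switch: "k < steps \<Longrightarrow> k \<notin> fan_steps \<Longrightarrow> group_code (residue 0 k) = 1"
  by (simp add: residue_def apex_def)

lemma residue_in_edges: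
  assumes "k \<in> fan_steps"
  shows "residue 0 k \<in> set es"
proof -
  obtain i i' where r: "i < 2 * h" "i' < 2 * h" "residue 0 k = {vx 1 i, vx 2 i'}"
    by (rule residue_bounds[OF assms shifts(1,2)])
  show ?thesis unfolding r(3) using r(1,2) by (intro edge_in vx_n) simp_all
qed

text \<open>
  Each of the quadratically many residues along the rim of the first fan survives: they are
  pairwise distinct, and they differ in group from every other term.
\<close>
lemma grid_column_weight:
  assumes ik: "i < 2 * h" "k < 2 * h"
  shows "2 * h\<^sup>2 \<le> weight (grid_column i k)"
proof -
  have one: "R (grid_column i k) (residue 0 l) \<noteq> 0" if l: "l \<in> fan_steps" for l
  proof -
    let ?a = "residue 0 l"
    have g: "group_code ?a = 6" by (rule group_code_residue_fan[OF l])
    have z: "ind ?a b = 0" if "group_code b \<noteq> 6" for b using that g by (auto simp: ind_def)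
    have "(\<Sum>l'<steps. ind ?a (residue 0 l')) = (\<Sum>l'\<in>{l}. ind ?a (residue 0 l'))"
    proof (rule sum.mono_neutral_right)
      show "{l} \<subseteq> {..<steps}" using l by (simp add: fan_steps_def)
      show "\<forall>l'\<in>{..<steps} - {l}. ind ?a (residue 0 l') = 0"
      proof
        fix l' assume l': "l' \<in> {..<steps} - {l}"
        show "ind ?a (residue 0 l') = 0"
        proof (cases "l' \<in> fan_steps")
          case True
          then show ?thesis using residue_inj[OF l True, of 0] l' by (auto simp: ind_def)
        next
          case False
          then show ?thesis using group_code_residue_switch[of l'] l' by (intro z) simp
        qed
      qed
    qed simp
    moreover have "group_code (rung 0 steps) \<noteq> 6" using group_code_rung_0[of steps] by auto
    ultimately have "grid_result i k ?a = ind ?a ?a"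
      unfolding grid_result_def using z[of "{vx 4 i, vx 5 k}"] z[of "{vx 0 0, vx 4 i}"]
        z[of "{vx 1 0, vx 5 k}"] z[of "rung 0 steps"] by simp
    then show ?thesis
      unfolding grid_column_reduced[OF ik residue_in_edges[OF l]] by (simp add: ind_def)
  qed
  have "inj_on (residue 0) fan_steps" using residue_inj[of _ _ 0] by (intro inj_onI) simp
  then have "card fan_steps = card (residue 0 ` fan_steps)" by (simp add: card_image)
  also have "\<dots> \<le> weight (grid_column i k)"
    unfolding weight_def using one residue_in_edges by (intro card_mono) auto
  finally show ?thesis using card_fan_steps by simp
qed

section \<open>Expensive columns\<close>

definition cone_column :: "nat \<Rightarrow> nat \<Rightarrow> nat \<Rightarrow> nat set" where
  "cone_column c i k = {vx 6 c, vx 1 i, vx 2 k}"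

text \<open>
  The residues of the second fan along its rim are grid edges; these are the columns that
  have them as pivots.
\<close>
definition dense_columns :: "nat set set" where
  "dense_columns = (\<lambda>l. insert (vx 7 0) (residue 3 l)) ` fan_steps"

text \<open>
  As for the grid edges, three triangles of the cone at \<open>vx 6 c\<close> and the second fan turn the
  column of \<open>cone_column c i k\<close> into a sum of grid edges and old edges; the dense columns
  then remove all grid edges.
\<close>
definition cone_reducers :: "nat \<Rightarrow> nat \<Rightarrow> nat \<Rightarrow> nat set set" where
  "cone_reducers c i k = insert {vx 6 c, vx 1 i, vx 3 0} (insert {vx 6 c, vx 2 k, vx 4 0}
     (insert {vx 6 c, vx 3 0, vx 4 0} (fan 3 ` {..<steps} \<union> dense_columns)))"

lemma dense_column_form:
  assumes "l \<in> fan_steps"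
  obtains i k where "i < 2 * h" "k < 2 * h" "residue 3 l = {vx 4 i, vx 5 k}"
    "insert (vx 7 0) (residue 3 l) = grid_column i k"
proof (rule residue_bounds[OF assms shifts(3,4)])
  fix i k assume *: "i < 2 * h" "k < 2 * h" "residue 3 l = {vx 4 i, vx 5 k}"
  show thesis by (rule that[OF *]) (simp only: *(3) grid_column_def)
qed

lemma inj_dense: "inj_on (\<lambda>l. insert (vx 7 0) (residue 3 l)) fan_steps"
proof (rule inj_onI)
  fix l l' assume l: "l \<in> fan_steps" "l' \<in> fan_steps"
    and eq: "insert (vx 7 0) (residue 3 l) = insert (vx 7 0) (residue 3 l')"
  obtain i k where r: "residue 3 l = {vx 4 i, vx 5 k}" by (rule dense_column_form[OF l(1)])
  obtain i' k' where r': "residue 3 l' = {vx 4 i', vx 5 k'}" by (rule dense_column_form[OF l(2)])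
  have "vx 7 0 \<notin> residue 3 l" "vx 7 0 \<notin> residue 3 l'" unfolding r r' by simp_all
  then have "residue 3 l = residue 3 l'" using eq by (rule iffD1[OF insert_ident])
  then show "l = l'" using residue_inj[OF l, of 3] by simp
qed

lemma cone_column_in:
  assumes "c < 2 * h" "i < 2 * h" "k < 2 * h"
  shows "cone_column c i k \<in> set ts" "last_edge es (cone_column c i k) = position es {vx 6 c, vx 2 k}"
    "{vx 6 c, vx 2 k} \<in> set es" "\<nexists>e. opens e (cone_column c i k)"
proof -
  have lt: "vx 6 c < n" "vx 2 k < n" "vx 1 i < n" using assms by (intro vx_n; simp)+
  have d: "distinct [vx 6 c, vx 2 k, vx 1 i]" by simp
  have eq: "cone_column c i k = {vx 6 c, vx 2 k, vx 1 i}" unfolding cone_column_def by blast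
  have "{vx 2 k, vx 1 i} = {vx 1 i, vx 2 k}" by blast
  then have k: "key {vx 6 c, vx 1 i} < key {vx 6 c, vx 2 k}" "key {vx 2 k, vx 1 i} < key {vx 6 c, vx 2 k}"
    using key_cones1[OF assms(1,2)] key_cones2[OF assms(1,3)] key_old[OF old_edges.grid12[OF assms(2,3)]]
    by simp_all
  show "cone_column c i k \<in> set ts" unfolding eq by (rule triangle_in[OF d lt])
  show "last_edge es (cone_column c i k) = position es {vx 6 c, vx 2 k}"
    unfolding eq by (rule last_edge_eq[OF d lt k])
  show "{vx 6 c, vx 2 k} \<in> set es" using lt by (intro edge_in) simp_all
  show "\<nexists>e. opens e (cone_column c i k)" using opens_not(2) unfolding cone_column_def by blast
qed

text \<open>
  What remains after all these additions is old.
\<close>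
lemma cone_combination:
  assumes a: "a \<in> set es" "a \<notin> old_edges" and cik: "c < 2 * h" "i < 2 * h" "k < 2 * h"
  shows "of_bool (a \<subseteq> cone_column c i k) + (\<Sum>t\<in>cone_reducers c i k. R t a) = 0"
proof -
  let ?t1 = "{vx 6 c, vx 1 i, vx 3 0}" and ?t2 = "{vx 6 c, vx 2 k, vx 4 0}" and ?t3 = "{vx 6 c, vx 3 0, vx 4 0}"
  let ?X = "fan 3 ` {..<steps} \<union> dense_columns"
  have "vx 6 c \<notin> t" if t: "t \<in> ?X" for t
    using t
  proof
    assume "t \<in> fan 3 ` {..<steps}"
    then show ?thesis using vx_notin_fan[of _ 3 6 c] by auto
  next
    assume "t \<in> dense_columns"
    then obtain l where l: "l \<in> fan_steps" "t = insert (vx 7 0) (residue 3 l)"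
      unfolding dense_columns_def by blast
    obtain i k where "t = grid_column i k" unfolding l(2) by (rule dense_column_form[OF l(1)])
    then show ?thesis by (simp add: grid_column_def)
  qed
  then have nX: "t \<notin> ?X" if "vx 6 c \<in> t" for t using that by blast
  have "vx 1 i \<notin> ?t2" "vx 1 i \<notin> ?t3" "vx 2 k \<notin> ?t3" by simp_all
  then have d: "?t1 \<noteq> ?t2" "?t1 \<noteq> ?t3" "?t2 \<noteq> ?t3" by blast+
  have n: "?t1 \<notin> insert ?t2 (insert ?t3 ?X)" "?t2 \<notin> insert ?t3 ?X" "?t3 \<notin> ?X"
    using nX[of ?t1] nX[of ?t2] nX[of ?t3] d by blast+
  have finX: "finite ?X" by (simp add: dense_columns_def finite_fan_steps)
  \<comment> \<open>Dense columns contain \<open>vx 7 0\<close>, which is in no fan.\<close>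
  have disj: "fan 3 ` {..<steps} \<inter> dense_columns = {}"
    using vx_notin_fan[of _ 3 7 0] unfolding dense_columns_def by fastforce
  have "(\<Sum>t\<in>cone_reducers c i k. R t a) = R ?t1 a + (R ?t2 a + (R ?t3 a + (\<Sum>t\<in>?X. R t a)))"
    unfolding cone_reducers_def using n finX by (simp del: Un_iff)
  moreover have "(\<Sum>t\<in>?X. R t a) = (\<Sum>t\<in>fan 3 ` {..<steps}. R t a) + (\<Sum>t\<in>dense_columns. R t a)"
    using disj by (intro sum.union_disjoint) (simp_all add: dense_columns_def finite_fan_steps)
  moreover have "R ?t1 a = ind a {vx 6 c, vx 1 i} + ind a {vx 1 i, vx 3 0} + ind a {vx 6 c, vx 3 0}"
    unfolding opens_column(1)[OF opens.cones1[OF cik(1,2)] a(1)] by (rule boundary_triple[OF a(1)]) simp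
  moreover have "R ?t2 a = ind a {vx 6 c, vx 2 k} + ind a {vx 2 k, vx 4 0} + ind a {vx 6 c, vx 4 0}"
    unfolding opens_column(1)[OF opens.cones2[OF cik(1,3)] a(1)] by (rule boundary_triple[OF a(1)]) simp
  moreover have "R ?t3 a = ind a {vx 6 c, vx 3 0} + ind a {vx 3 0, vx 4 0} + ind a {vx 6 c, vx 4 0}"
    unfolding opens_column(1)[OF opens.cones3[OF cik(1)] a(1)] by (rule boundary_triple[OF a(1)]) simp
  moreover have "of_bool (a \<subseteq> cone_column c i k) =
      ind a {vx 6 c, vx 1 i} + ind a {vx 1 i, vx 2 k} + ind a {vx 6 c, vx 2 k}"
    unfolding cone_column_def by (rule boundary_triple[OF a(1)]) simp
  moreover have "(\<Sum>t\<in>fan 3 ` {..<steps}. R t a) =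
      ind a {vx 3 0, vx 4 0} + ind a (rung 3 steps) + (\<Sum>l<steps. ind a (residue 3 l))"
    unfolding rung_3_0[symmetric] by (rule sum_fans[OF a(1)]) (simp_all add: opens_fan)
  \<comment> \<open>At a change of apex the residue is old.\<close>
  moreover have "(\<Sum>l<steps. ind a (residue 3 l)) = (\<Sum>l\<in>fan_steps. ind a (residue 3 l))"
    using ind_old[OF a(2) residue_3_old] by (intro sum.mono_neutral_right) (auto simp: fan_steps_def)
  moreover have "(\<Sum>t\<in>dense_columns. R t a) = (\<Sum>l\<in>fan_steps. ind a (residue 3 l))"
    unfolding dense_columns_def sum.reindex[OF inj_dense] o_def
  proof (rule sum.cong[OF refl])
    fix l assume l: "l \<in> fan_steps"
    obtain i k where r: "i < 2 * h" "k < 2 * h" "residue 3 l = {vx 4 i, vx 5 k}"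
      "insert (vx 7 0) (residue 3 l) = grid_column i k"
      by (rule dense_column_form[OF l])
    show "R (insert (vx 7 0) (residue 3 l)) a = ind a (residue 3 l)"
      unfolding r(4) unfolding r(3)
      using grid_column_reduced[OF r(1,2) a(1)] grid_result_young[OF a(2) r(1,2)] by simp
  qed
  moreover have "ind a {vx 1 i, vx 3 0} = 0" "ind a {vx 2 k, vx 4 0} = 0" "ind a {vx 6 c, vx 4 0} = 0"
      "ind a {vx 1 i, vx 2 k} = 0" "ind a (rung 3 steps) = 0"
    using ind_old[OF a(2) old_edges.star31[OF cik(2)]] ind_old[OF a(2) old_edges.star42[OF cik(3)]]
      ind_old[OF a(2) old_edges.star46[OF cik(1)]] ind_old[OF a(2) old_edges.grid12[OF cik(2,3)]]
      ind_old[OF a(2) old_edges.last3] by (simp_all only: insert_commute)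
  ultimately show ?thesis
    by (simp only: ac_simps bit_add_cancel bit_add_self add_0_right add_0_left)
qed

lemma cone_reducer_earlier:
  assumes t: "t \<in> cone_reducers c i k" and cik: "c < 2 * h" "i < 2 * h" "k < 2 * h"
  shows "t \<in> set ts \<and> position ts t < position ts (cone_column c i k)"
proof -
  let ?s = "cone_column c i k" and ?top = "{vx 6 c, vx 2 k}"
  note s = cone_column_in[OF cik]
  have top: "key ?top = 2 * steps + 9" by (rule key_cones2[OF cik(1,3)])
  have *: "t \<in> set ts \<and> position ts t < position ts ?s" if "opens e t" "key e < 2 * steps + 9 \<or> e = ?top" for e
  proof
    show "t \<in> set ts" by (rule opens_in(1)[OF that(1)])
    have "key e < key ?top \<or> e = ?top \<and> (\<nexists>e. opens e ?s)" using that(2) top s(4) by auto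
    then show "position ts t < position ts ?s" by (rule opens_earlier[OF that(1) s(1-3)])
  qed
  consider "t = {vx 6 c, vx 1 i, vx 3 0}" | "t = {vx 6 c, vx 2 k, vx 4 0}" | "t = {vx 6 c, vx 3 0, vx 4 0}"
    | l where "l < steps" "t = fan 3 l" | l where "l \<in> fan_steps" "t = insert (vx 7 0) (residue 3 l)"
    using t unfolding cone_reducers_def dense_columns_def by blast
  then show ?thesis
  proof cases
    case 1
    show ?thesis by (rule *[OF opens.cones1[OF cik(1,2), folded 1]]) (simp only: key_cones1[OF cik(1,2)], simp)
  next
    case 2
    show ?thesis by (rule *[OF opens.cones2[OF cik(1,3), folded 2]]) simp
  next
    case 3
    show ?thesis by (rule *[OF opens.cones3[OF cik(1), folded 3]]) (simp add: key_cones3 cik)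
  next
    case (4 l)
    show ?thesis by (rule *[OF opens.fan3[OF 4(1), folded 4(2)]]) (rule disjI1, use key_rung3[OF 4(1)] in linarith)
  next
    case (5 l)
    obtain i' k' where r: "i' < 2 * h" "k' < 2 * h" "insert (vx 7 0) (residue 3 l) = grid_column i' k'"
      by (rule dense_column_form[OF 5(1)])
    note g = grid_column_in[OF r(1,2), folded r(3), folded 5(2)]
    have "key {vx 7 0, vx 5 k'} < key ?top" using key_cone5[OF r(2)] top by simp
    then have "last_edge es t < last_edge es ?s"
      using key_less[OF g(3) s(3)] g(2) s(2) by simp
    then show ?thesis using triangle_less[OF g(1) s(1)] g(1) by blast
  qed
qed

text \<open>
  The old edges form an initial segment of the rows, as \<open>added_iff\<close> requires.
\<close>
lemma old_threshold: "\<exists>b. \<forall>a\<in>set es. b \<le> position es a \<longleftrightarrow> a \<notin> old_edges"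
proof -
  let ?A = "position es ` (set es \<inter> old_edges)"
  have "b < Suc (Max ?A)" if "b \<in> ?A" for b
    using that Max_ge[of ?A b] by (simp add: less_Suc_eq_le)
  moreover have "Suc (Max ?A) \<le> position es a" if a: "a \<in> set es" "a \<notin> old_edges" for a
  proof -
    have tip: "{vx 7 0, vx 1 0} \<in> set es" using h by (intro edge_in vx_n) simp_all
    have "?A \<noteq> {}" using tip old_edges.tip by blast
    then have "Max ?A \<in> ?A" by (intro Max_in) auto
    then obtain b where b: "b \<in> set es" "b \<in> old_edges" "Max ?A = position es b" by auto
    have "key b < key a" using key_old[OF b(2)] key_0_iff[of a] a(2) by simp
    then show ?thesis using key_less[OF b(1) a(1)] b(3) by simp
  qed
  ultimately have "\<forall>a\<in>set es. Suc (Max ?A) \<le> position es a \<longleftrightarrow> a \<notin> old_edges"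
    by (meson IntI imageI leD)
  then show ?thesis by blast
qed

lemma dense_columns_added:
  assumes cik: "c < 2 * h" "i < 2 * h" "k < 2 * h"
  shows "dense_columns \<subseteq> U (cone_column c i k)"
proof
  fix t assume t: "t \<in> dense_columns"
  then obtain l where l: "l \<in> fan_steps" "t = insert (vx 7 0) (residue 3 l)"
    unfolding dense_columns_def by blast
  obtain i' k' where r: "i' < 2 * h" "k' < 2 * h" "insert (vx 7 0) (residue 3 l) = grid_column i' k'"
    by (rule dense_column_form[OF l(1)])
  obtain b where b: "\<And>a. a \<in> set es \<Longrightarrow> b \<le> position es a \<longleftrightarrow> a \<notin> old_edges"
    using old_threshold by blast
  have "piv t {vx 4 i', vx 5 k'}"
    unfolding l(2) r(3) by (rule pivot_grid_result[OF r(1,2)]) (rule grid_column_reduced[OF r(1,2)])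
  moreover have "{vx 4 i', vx 5 k'} \<notin> old_edges"
    using key_grid_edge[OF r(1,2)] key_0_iff[of "{vx 4 i', vx 5 k'}"] by simp
  then have "b \<le> position es {vx 4 i', vx 5 k'}" using b[OF grid_edge_in[OF r(1,2)]] by blast
  moreover have "t \<in> cone_reducers c i k" using t unfolding cone_reducers_def by blast
  ultimately show "t \<in> U (cone_column c i k)"
    using added_iff[OF cone_column_in(1)[OF cik] cone_reducer_earlier[OF _ cik] cone_combination[OF _ _ cik], of b]
      b by blast
qed

lemma cone_column_cost:
  assumes cik: "c < 2 * h" "i < 2 * h" "k < 2 * h"
  shows "2 * h\<^sup>2 * (2 * h\<^sup>2) \<le> (\<Sum>t\<in>U (cone_column c i k). weight t)"
proof -
  have "2 * h\<^sup>2 * (2 * h\<^sup>2) \<le> card dense_columns * (2 * h\<^sup>2)"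
    using card_fan_steps card_image[OF inj_dense] by (intro mult_le_mono1) (simp add: dense_columns_def)
  also have "\<dots> = (\<Sum>t\<in>dense_columns. 2 * h\<^sup>2)" by simp
  also have "\<dots> \<le> (\<Sum>t\<in>dense_columns. weight t)"
  proof (rule sum_mono)
    fix t assume "t \<in> dense_columns"
    then obtain l where l: "l \<in> fan_steps" "t = insert (vx 7 0) (residue 3 l)"
      unfolding dense_columns_def by blast
    obtain i' k' where r: "i' < 2 * h" "k' < 2 * h" "insert (vx 7 0) (residue 3 l) = grid_column i' k'"
      by (rule dense_column_form[OF l(1)])
    show "2 * h\<^sup>2 \<le> weight t" unfolding l(2) r(3) by (rule grid_column_weight[OF r(1,2)])
  qed
  also have "\<dots> \<le> (\<Sum>t\<in>U (cone_column c i k). weight t)"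
    using dense_columns_added[OF cik] finite_added[OF cone_column_in(1)[OF cik]]
    by (intro sum_mono2) simp_all
  finally show ?thesis .
qed

text \<open>
  There are \<open>8 * h ^ 3\<close> final triangles. Each of them uses at least \<open>2 * h ^ 2\<close> dense
  columns, of at least \<open>2 * h ^ 2\<close> entries each.
\<close>
lemma cost_lower_bound: "h ^ 7 \<le> (\<Sum>s\<in>set ts. \<Sum>t\<in>U s. weight t)"
proof -
  let ?I = "{..<2 * h} \<times> {..<2 * h} \<times> {..<2 * h}" and ?f = "\<lambda>(c, i, k). cone_column c i k"
  have inj: "inj_on ?f ?I"
  proof (rule inj_onI)
    fix p q assume "p \<in> ?I" "q \<in> ?I" and eq: "?f p = ?f q"
    obtain c i k c' i' k' where pq: "p = (c, i, k)" "q = (c', i', k')" by (metis prod_cases3)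
    have e: "{vx 6 c, vx 1 i, vx 2 k} = {vx 6 c', vx 1 i', vx 2 k'}"
      using eq by (simp add: pq cone_column_def)
    have "vx 6 c \<in> {vx 6 c', vx 1 i', vx 2 k'}" "vx 1 i \<in> {vx 6 c', vx 1 i', vx 2 k'}"
      "vx 2 k \<in> {vx 6 c', vx 1 i', vx 2 k'}" unfolding e[symmetric] by simp_all
    then show "p = q" by (simp add: pq)
  qed
  have "h ^ 7 = 1 * h ^ 7" by simp
  also have "\<dots> \<le> 32 * h ^ 7" by (rule mult_le_mono1) simp
  also have "\<dots> = card ?I * (2 * h\<^sup>2 * (2 * h\<^sup>2))"
  proof -
    have "h ^ 7 = h ^ 3 * h\<^sup>2 * h\<^sup>2" by (simp flip: power_add)
    then show ?thesis
      unfolding card_cartesian_product card_lessThan by (simp add: power3_eq_cube)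
  qed
  also have "\<dots> = (\<Sum>p\<in>?I. 2 * h\<^sup>2 * (2 * h\<^sup>2))" by simp
  also have "\<dots> \<le> (\<Sum>p\<in>?I. \<Sum>t\<in>U (?f p). weight t)"
  proof (rule sum_mono)
    fix p assume "p \<in> ?I"
    then show "2 * h\<^sup>2 * (2 * h\<^sup>2) \<le> (\<Sum>t\<in>U (?f p). weight t)"
      by (cases p) (simp only: mem_Sigma_iff lessThan_iff split cone_column_cost)
  qed
  also have "\<dots> = (\<Sum>s\<in>?f ` ?I. \<Sum>t\<in>U s. weight t)"
    by (subst sum.reindex[OF inj]) simp
  also have "\<dots> \<le> (\<Sum>s\<in>set ts. \<Sum>t\<in>U s. weight t)"
    using cone_column_in(1) by (intro sum_mono2) auto
  finally show ?thesis .
qed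

end

section \<open>Asymptotics\<close>

lemma card_subsets_le: "card {s. s \<noteq> {} \<and> s \<subseteq> {..<n} \<and> card s = k} \<le> n ^ k"
proof -
  have "card {s. s \<noteq> {} \<and> s \<subseteq> {..<n} \<and> card s = k} \<le> card {s. s \<subseteq> {..<n} \<and> card s = k}"
    by (rule card_mono) (auto intro: finite_subset[of _ "Pow {..<n}"])
  also have "\<dots> = n choose k" using n_subsets[of "{..<n}" k] by simp
  also have "\<dots> \<le> n ^ k" by (cases "k \<le> n") (simp_all add: binomial_le_pow binomial_eq_0)
  finally show ?thesis .
qed

text \<open>
  Eight groups of \<open>2 * (n div 16)\<close> vertices fit among \<open>n\<close> vertices.
\<close>
definition fans_edges :: "nat \<Rightarrow> nat set list" where
  "fans_edges n = edge_sequence n (nested_fans.key (n div 16))"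

definition fans_triangles :: "nat \<Rightarrow> nat set list" where
  "fans_triangles n = triangle_sequence n (fans_edges n) {t. \<exists>e. nested_fans.opens (n div 16) e t}"

abbreviation fans_matrix :: "nat \<Rightarrow> bit mat" where
  "fans_matrix n \<equiv> boundary_matrix (fans_edges n) (fans_triangles n)"

text \<open>
  The first two bounds hold for every filtration; only the third one uses the construction.
\<close>
lemma fans_bounds:
  "fill_in (fans_matrix n) \<le> n ^ 4"
  "reduction_cost (fans_matrix n) \<le> n ^ 3 * fill_in (fans_matrix n)"
  "16 \<le> n \<Longrightarrow> (n div 16) ^ 7 \<le> reduction_cost (fans_matrix n)"
proof -
  let ?es = "fans_edges n" and ?ts = "fans_triangles n"
  have "distinct ?es" "distinct ?ts"
    unfolding fans_triangles_def fans_edges_def by (rule edge_sequence triangle_sequence)+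
  from boundary_matrix_reduction[OF this] obtain R U where
    red: "column_reduction (set ?ts) (set ?es) (position ?ts) (position ?es) (\<lambda>t e. of_bool (e \<subseteq> t)) R U"
    and fill: "fill_in (fans_matrix n) = (\<Sum>s\<in>set ?ts. column_reduction.weight (set ?es) R s)"
    and cost: "reduction_cost (fans_matrix n) = (\<Sum>s\<in>set ?ts. \<Sum>t\<in>U s. column_reduction.weight (set ?es) R t)" .
  interpret column_reduction "set ?ts" "set ?es" "position ?ts" "position ?es" "\<lambda>t e. of_bool (e \<subseteq> t)" R U
    by (rule red)
  have "card (set ?es) \<le> n ^ 2"
    using card_subsets_le[of n 2] unfolding fans_edges_def edge_sequence
    by (simp add: edges_of_def full_simplex_def conj_assoc)
  then have "card (set ?es) ^ 2 \<le> (n ^ 2) ^ 2" by (rule power_mono) simp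
  then show "fill_in (fans_matrix n) \<le> n ^ 4"
    unfolding fill using total_weight_le by (simp flip: power_mult)
  have "card (set ?ts) \<le> n ^ 3"
    using card_subsets_le[of n 3] unfolding fans_triangles_def triangle_sequence
    by (simp add: triangles_of_def full_simplex_def conj_assoc)
  then show "reduction_cost (fans_matrix n) \<le> n ^ 3 * fill_in (fans_matrix n)"
    unfolding fill cost using total_cost_le by (meson le_trans mult_le_mono1)
  show "(n div 16) ^ 7 \<le> reduction_cost (fans_matrix n)" if n: "16 \<le> n"
  proof -
    interpret nested_fans_reduction "n div 16" n ?es ?ts R U
    proof
      show "0 < n div 16" using n by simp
    qed (simp_all add: fans_edges_def fans_triangles_def red[unfolded fans_edges_def fans_triangles_def])
    show ?thesis unfolding cost by (rule cost_lower_bound)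
  qed
qed

text \<open>
  The fill-in is bounded from below through the cost, which exceeds it by at most a factor
  \<open>n ^ 3\<close>.
\<close>
lemma fans_lower_bounds:
  assumes "16 \<le> n"
  shows "n ^ 7 \<le> 32 ^ 7 * reduction_cost (fans_matrix n)"
    and "n ^ 4 \<le> 32 ^ 7 * fill_in (fans_matrix n)"
proof -
  have "n = 16 * (n div 16) + n mod 16" "n mod 16 < 16" "1 \<le> n div 16" using assms by simp_all
  then have "n \<le> 32 * (n div 16)" by linarith
  then have "n ^ 7 \<le> (32 * (n div 16)) ^ 7" by (rule power_mono) simp
  also have "\<dots> = 32 ^ 7 * (n div 16) ^ 7" by (rule power_mult_distrib)
  also have "\<dots> \<le> 32 ^ 7 * reduction_cost (fans_matrix n)"
    by (rule mult_le_mono2[OF fans_bounds(3)[OF assms]])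
  finally show cost: "n ^ 7 \<le> 32 ^ 7 * reduction_cost (fans_matrix n)" .
  also have "\<dots> \<le> 32 ^ 7 * (n ^ 3 * fill_in (fans_matrix n))"
    by (rule mult_le_mono2[OF fans_bounds(2)])
  finally have le: "n ^ 7 \<le> 32 ^ 7 * (n ^ 3 * fill_in (fans_matrix n))" .
  have "n ^ 7 = n ^ 3 * n ^ 4" by (simp flip: power_add)
  then have "n ^ 3 * n ^ 4 \<le> n ^ 3 * (32 ^ 7 * fill_in (fans_matrix n))"
    using le by (simp only: mult.left_commute)
  moreover have "0 < n ^ 3" using assms by simp
  ultimately show "n ^ 4 \<le> 32 ^ 7 * fill_in (fans_matrix n)"
    by (simp only: nat_mult_le_cancel1)
qed

lemma bigtheta_of_nat_bounds:
  fixes f g :: "nat \<Rightarrow> nat"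
  assumes "\<And>n. f n \<le> g n" "\<And>n. N \<le> n \<Longrightarrow> g n \<le> C * f n"
  shows "(\<lambda>n. real (f n)) \<in> \<Theta>(\<lambda>n. real (g n))"
proof
  show "(\<lambda>n. real (f n)) \<in> O(\<lambda>n. real (g n))"
    by (rule bigoI[where c = 1]) (simp add: assms(1))
  have "(\<lambda>n. real (g n)) \<in> O(\<lambda>n. real (f n))"
  proof (rule bigoI[where c = "real C"])
    have "norm (real (g n)) \<le> real C * norm (real (f n))" if "N \<le> n" for n
      using of_nat_mono[OF assms(2)[OF that], where ?'a = real] by simp
    then show "\<forall>\<^sub>F n in sequentially. norm (real (g n)) \<le> real C * norm (real (f n))"
      by (rule eventually_sequentiallyI)
  qed
  then show "(\<lambda>n. real (f n)) \<in> \<Omega>(\<lambda>n. real (g n))" by (simp add: bigomega_iff_bigo)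
qed

theorem theorem8p1:
  "\<exists>es ts :: nat \<Rightarrow> nat set list.
     (\<forall>n. clique_filtration n (es n) (ts n)) \<and>
     (\<lambda>n. real (fill_in (boundary_matrix (es n) (ts n)))) \<in> \<Theta>(\<lambda>n. real n ^ 4) \<and>
     (\<lambda>n. real (reduction_cost (boundary_matrix (es n) (ts n)))) \<in> \<Theta>(\<lambda>n. real n ^ 7)"
proof (intro exI conjI allI)
  show "clique_filtration n (fans_edges n) (fans_triangles n)" for n
    unfolding fans_triangles_def fans_edges_def by (rule clique_filtration_sequences)
  have "reduction_cost (fans_matrix n) \<le> n ^ 7" for n
  proof -
    have "reduction_cost (fans_matrix n) \<le> n ^ 3 * n ^ 4"
      using fans_bounds(2) mult_le_mono2[OF fans_bounds(1)] by (rule le_trans)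
    then show ?thesis by (simp flip: power_add)
  qed
  from bigtheta_of_nat_bounds[OF this fans_lower_bounds(1)]
  show "(\<lambda>n. real (reduction_cost (fans_matrix n))) \<in> \<Theta>(\<lambda>n. real n ^ 7)" by simp
  from bigtheta_of_nat_bounds[OF fans_bounds(1) fans_lower_bounds(2)]
  show "(\<lambda>n. real (fill_in (fans_matrix n))) \<in> \<Theta>(\<lambda>n. real n ^ 4)" by simp
qed

end
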